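(* Let $\nu$ be a valuation on $K[x]$ and let $Q$ be a limit key polynomial for $\nu$, with associated key polynomial $Q_-$ (so that conditions (K1)–(K4) hold for $Q$ and $Q_-$). Then the family $$\mathcal F=\{(\nu_{Q'},Q',\nu(Q'))\}_{Q'\in\Psi(Q_-)},$$ ordered by $\epsilon$, is a continued family of augmented (iterated) valuations on $K[x]$, and $Q$ is a limit MacLane–Vaquié key polynomial for $\mathcal F$. Moreover, $$\nu_Q=[\nu_{\mathcal F};\nu_Q(Q)=\nu(Q)].$$
   Context: **Valuations.** $K$ is a field. For an ordered abelian group $\Gamma$, $\Gamma_\infty=\Gamma\cup\{\infty\}$ with the usual extension of order and addition. A valuation on $K[x]$ is a map $\nu:K[x]\to\Gamma_\infty$ with $\nu(fg)=\nu(f)+\nu(g)$, $\nu(f+g)\ge\min\{\nu(f),\nu(g)\}$, $\nu(1)=0$, $\nu(0)=\infty$ (nonzero polynomials may have value $\infty$). The $q$-expansion of $f$ is the unique expression $f=\sum_i f_iq^i$ with $\deg(f_i)<\deg(q)$. **Key polynomials.** $\partial_kf=\frac1{k!}\frac{d^kf}{dx^k}$ is the Hasse derivative of $f$ of order $k$. Set $\epsilon(f)=\max_{k\in\mathbb N}\{(\nu(f)-\nu(\partial_kf))/k\}\in\Gamma\otimes\mathbb Q$. A monic polynomial $Q$ is a key polynomial for $\nu$ if for every $f\in K[x]$, $\epsilon(f)\geq\epsilon(Q)$ implies $\deg(f)\ge\deg(Q)$. The truncation of $\nu$ at $Q$ is $\nu_Q(f)=\min_i\nu(f_iQ^i)$,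 where $f=\sum_i f_iQ^i$ is the $Q$-expansion; it is a valuation when $Q$ is a key polynomial. Set $\alpha(Q)=\min\{\deg(f)\mid\nu_Q(f)<\nu(f)\}$ ($=\infty$ if $\nu_Q=\nu$) and $\Psi(Q)=\{f\in K[x]\mid f\text{ monic},\ \nu_Q(f)<\nu(f),\ \deg(f)=\alpha(Q)\}$. Ordering by $\epsilon$ means $Q'<Q''$ if $\epsilon(Q')<\epsilon(Q'')$. **Limit key polynomials.** A monic polynomial $Q$ is a limit key polynomial for $\nu$ if there is a key polynomial $Q_-$ such that: (K1) $\alpha(Q_-)=\deg(Q_-)$; (K2) the set $\{\nu(Q')\mid Q'\in\Psi(Q_-)\}$ does not contain a maximal element; (K3) $\nu_{Q'}(Q)<\nu(Q)$ for every $Q'\in\Psi(Q_-)$; (K4) $Q$ has the smallest degree among polynomials satisfying (K3). **MacLane–Vaquié key polynomials.** For a valuation $\mu$ on $K[x]$, the graded algebra of $\mu$ is $\bigoplus_{\gamma}\mathcal P_\gamma/\mathcal P_\gamma^+$, where $\gamma$ runs over the values $\mu(a)\neq\infty$ of elements $a\in K[x]$, $\mathcal P_\gamma=\{a\mid\mu(a)\ge\gamma\}$ and $\mathcal P_\gamma^+=\{a\mid\mu(a)>\gamma\}$; ${\rm in}_\mu(a)$ is the image of $a$ in $\mathcal P_{\mu(a)}/\mathcal P_{\mu(a)}^+$. For $f,g\in K[x]$: $f\sim_\mu g$ means ${\rm in}_\mu(f)={\rm in}_\mu(g)$; $g\mid_\mu f$ means there is $h\in K[x]$ with $f\sim_\mu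 gh$. A monic $P\in K[x]$ is a MacLane–Vaquié key polynomial for $\mu$ if (KP1) $P\mid_\mu fg$ implies $P\mid_\mu f$ or $P\mid_\mu g$, and (KP2) for every $f\in K[x]$, $P\mid_\mu f$ implies $\deg(f)\ge\deg(P)$. The expression $\mu'=[\mu;\mu'(P)=\gamma]$ means: $P$ is a MacLane–Vaquié key polynomial for $\mu$, $\gamma>\mu(P)$ with $\gamma$ in a group extension of the value group of $\mu$, and $\mu'(f)=\min_i\{\mu(f_i)+i\gamma\}$ where $f=\sum_i f_iP^i$ is the $P$-expansion. **Families.** Let $A$ be a totally ordered set and $\mathcal F=\{(\nu_\alpha,Q_\alpha,\gamma_\alpha)\}_{\alpha\in A}$ with $\nu_\alpha$ a valuation on $K[x]$, $Q_\alpha\in K[x]$, $\gamma_\alpha$ in a fixed ordered abelian group. $\mathcal F$ is a family of augmented iterated valuations if for every $\alpha\in A$, except the smallest element of $A$, there is $\alpha_-\in A$, $\alpha_-<\alpha$, with $\nu_\alpha=[\nu_{\alpha_-};\nu_\alpha(Q_\alpha)=\gamma_\alpha]$ and: (i) if $\alpha$ has an immediate predecessor in $A$, then $\alpha_-$ is that predecessor, and when $\alpha_-$ is not the smallest element of $A$, $Q_\alpha$ and $Q_{\alpha_-}$ are not $\nu_{\alpha_-}$-equivalent (i.e. $Q_\alpha\not\sim_{\nu_{\alpha_-}}Q_{\alpha_-}$) and $\deg(Q_{\alpha_-})\le\deg(Q_\alpha)$; (ii) if $\alpha$ has no immediate predecessor in $A$, then for every $\beta\in A$ with $\alpha_-<\beta<\alpha$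 we have $\nu_\beta=[\nu_{\alpha_-};\nu_\beta(Q_\beta)=\gamma_\beta]$ and $\nu_\alpha=[\nu_\beta;\nu_\alpha(Q_\alpha)=\gamma_\alpha]$, and $\deg(Q_\alpha)=\deg(Q_{\alpha_-})$. It is continued if $\{\gamma_\alpha\mid\alpha\in A\}$ has no maximal element, all $Q_\alpha$ have the same degree, and there is a valuation $\mu$ on $K[x]$ with $\nu_\alpha=[\mu;\nu_\alpha(Q_\alpha)=\gamma_\alpha]$ for every $\alpha\in A$. $f\mid_{\mathcal F}g$ means there is $\alpha_0\in A$ with $f\mid_{\nu_\alpha}g$ for all $\alpha\ge\alpha_0$. A monic $Q$ is a limit MacLane–Vaquié key polynomial for the continued family $\mathcal F$ if for $f,g\in K[x]$: (LKP1) $Q\mid_{\mathcal F}fg$ implies $Q\mid_{\mathcal F}f$ or $Q\mid_{\mathcal F}g$; (LKP2) $Q\mid_{\mathcal F}f$ implies $\deg(Q)\le\deg(f)$. If for $f\in K[x]$ there is $\alpha_f\in A$ with $\nu_\alpha(f)=\nu_{\alpha_f}(f)$ for all $\alpha\ge\alpha_f$, put $\nu_{\mathcal F}(f)=\nu_{\alpha_f}(f)$. The expression $\overline\nu=[\nu_{\mathcal F};\overline\nu(Q)=\gamma]$ means that $\gamma$, in some extension of the value group, satisfies $\gamma>\nu_\alpha(Q)$ for every $\alpha\in A$, and $\overline\nu(f)=\min_i\{\nu_{\mathcal F}(f_i)+i\gamma\}$, where $f=\sum_i f_iQ^i$ is the $Q$-expansion of $f$.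
   Formalization: Distinct elements of Ψ(Q_-) can have equal ε, so "totally ordered" is read up to ties (α_- is some immediate predecessor; ≥ means not <); γ=ν(Q)=∞ is allowed in [ν_F; ν_Q(Q)=ν(Q)]; the degree conditions (KP2), (LKP2) concern nonzero f; key polynomials are nonconstant. *)

theory Defs
  imports
    "HOL-Computational_Algebra.Polynomial"
    "HOL-Library.Extended"
    "HOL-Library.Extended_Nat"
begin

section \<open>Values\<close>

text \<open>The ordered monoid obtained from an ordered abelian group by adjoining a largest,
  absorbing element.\<close>

datatype 'g vext = Val 'g | Infty

instantiation vext :: (linorder) linorder
begin

fun less_eq_vext :: "'a vext \<Rightarrow> 'a vext \<Rightarrow> bool" where
  "Val x \<le> Val y \<longleftrightarrow> x \<le> y"
| "x \<le> Infty \<longleftrightarrow> True"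
| "Infty \<le> Val y \<longleftrightarrow> False"

definition less_vext :: "'a vext \<Rightarrow> 'a vext \<Rightarrow> bool" where
  "x < y \<longleftrightarrow> x \<le> y \<and> \<not> y \<le> (x :: 'a vext)"

instance
proof
  fix x y z :: "'a vext"
  show "x \<le> x" by (cases x) auto
  show "x \<le> y \<Longrightarrow> y \<le> z \<Longrightarrow> x \<le> z" by (cases x; cases y; cases z) auto
  show "x \<le> y \<Longrightarrow> y \<le> x \<Longrightarrow> x = y" by (cases x; cases y) auto
  show "x \<le> y \<or> y \<le> x" by (cases x; cases y) auto
qed (rule less_vext_def)

end

instantiation vext :: (comm_monoid_add) comm_monoid_add
begin

definition zero_vext :: "'a vext" where
  "0 = Val 0"

fun plus_vext :: "'a vext \<Rightarrow> 'a vext \<Rightarrow> 'a vext" where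
  "Val x + Val y = Val (x + y)"
| "Infty + y = Infty"
| "x + Infty = Infty"

instance
proof
  fix x y z :: "'a vext"
  show "x + y + z = x + (y + z)" by (cases x; cases y; cases z) (auto simp: add.assoc)
  show "x + y = y + x" by (cases x; cases y) (auto simp: add.commute)
  show "0 + x = x" by (cases x) (auto simp: zero_vext_def)
qed

end

primrec nmult :: "nat \<Rightarrow> 'm::comm_monoid_add \<Rightarrow> 'm" where
  "nmult 0 a = 0"
| "nmult (Suc n) a = a + nmult n a"

lemma nmult_nmult: "nmult m (nmult n a) = nmult (m * n) a"
proof -
  have "nmult (k + n) a = nmult k a + nmult n a" for k n
    by (induction k) (auto simp: add.assoc)
  then show ?thesis by (induction m) auto
qed

lemma nmult_Suc_strict_mono: "strict_mono (nmult (Suc n) :: 'g::linordered_ab_group_add \<Rightarrow> 'g)"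
proof -
  have "nmult n x \<le> nmult n y" if "x \<le> y" for n and x y :: 'g
    using that by (induction n) (auto intro: add_mono)
  then show ?thesis
    by (intro strict_monoI) (auto intro: add_less_le_mono)
qed

lemmas nmult_Suc_le_iff = strict_mono_less_eq [OF nmult_Suc_strict_mono]
lemmas nmult_Suc_eq_iff = strict_mono_eq [OF nmult_Suc_strict_mono]

text \<open>The ordered set underlying the tensor product of an ordered abelian group with the
  rationals: the pair \<open>(a, n)\<close> represents \<open>a / (n + 1)\<close>. (An ordered abelian group is torsion
  free, so its divisible hull is this set of fractions.)\<close>

definition frac_rel :: "'g::linordered_ab_group_add \<times> nat \<Rightarrow> 'g \<times> nat \<Rightarrow> bool" where
  "frac_rel p q \<longleftrightarrow> nmult (Suc (snd q)) (fst p) = nmult (Suc (snd p)) (fst q)"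

definition frac_le :: "'g::linordered_ab_group_add \<times> nat \<Rightarrow> 'g \<times> nat \<Rightarrow> bool" where
  "frac_le p q \<longleftrightarrow> nmult (Suc (snd q)) (fst p) \<le> nmult (Suc (snd p)) (fst q)"

lemma frac_le_trans:
  assumes "frac_le p q" "frac_le q r"
  shows "frac_le p r"
proof -
  obtain a k b m c n where pqr: "p = (a, k)" "q = (b, m)" "r = (c, n)"
    by (metis surj_pair)
  let ?M = "\<lambda>i. nmult (Suc i)"
  have swap: "?M i (?M j x) = ?M j (?M i x)" for i j and x :: 'a
    by (simp only: nmult_nmult mult.commute)
  have "?M m (?M n a) = ?M n (?M m a)" by (rule swap)
  also have "\<dots> \<le> ?M n (?M k b)"
    using assms(1) by (simp only: nmult_Suc_le_iff) (simp add: frac_le_def pqr)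
  also have "\<dots> = ?M k (?M n b)" by (rule swap)
  also have "\<dots> \<le> ?M k (?M m c)"
    using assms(2) by (simp only: nmult_Suc_le_iff) (simp add: frac_le_def pqr)
  also have "\<dots> = ?M m (?M k c)" by (rule swap)
  finally have "?M n a \<le> ?M k c" by (simp only: nmult_Suc_le_iff)
  then show ?thesis by (simp add: frac_le_def pqr)
qed

lemma frac_rel_iff: "frac_rel p q \<longleftrightarrow> frac_le p q \<and> frac_le q p"
  by (auto simp: frac_rel_def frac_le_def)

quotient_type (overloaded) 'g divhull = "'g::linordered_ab_group_add \<times> nat" / frac_rel
proof (rule equivpI)
  show "reflp frac_rel" by (rule reflpI) (simp add: frac_rel_def)
  show "symp frac_rel" by (rule sympI) (simp add: frac_rel_def)
  show "transp frac_rel" by (rule transpI) (auto simp: frac_rel_iff intro: frac_le_trans)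
qed

instantiation divhull :: (linordered_ab_group_add) linorder
begin

lift_definition less_eq_divhull :: "'a divhull \<Rightarrow> 'a divhull \<Rightarrow> bool" is frac_le
  by (auto simp: frac_rel_iff intro: frac_le_trans)

definition less_divhull :: "'a divhull \<Rightarrow> 'a divhull \<Rightarrow> bool" where
  "x < y \<longleftrightarrow> x \<le> y \<and> \<not> y \<le> (x :: 'a divhull)"

instance
proof
  fix x y z :: "'a divhull"
  show "x \<le> x" by transfer (simp add: frac_le_def)
  show "x \<le> y \<Longrightarrow> y \<le> z \<Longrightarrow> x \<le> z" by transfer (rule frac_le_trans)
  show "x \<le> y \<Longrightarrow> y \<le> x \<Longrightarrow> x = y" by transfer (simp add: frac_rel_iff)
  show "x \<le> y \<or> y \<le> x" by transfer (auto simp: frac_le_def)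
qed (rule less_divhull_def)

end

text \<open>\<open>a / k\<close>, for \<open>k \<ge> 1\<close>.\<close>

lift_definition divhull_frac :: "'g::linordered_ab_group_add \<Rightarrow> nat \<Rightarrow> 'g divhull"
  is "\<lambda>a k. (a, k - 1)" .


section \<open>Valuations and polynomial expansions\<close>

type_synonym ('k, 'g) pval = "'k poly \<Rightarrow> 'g vext"

definition valuation :: "('k::field, 'g::linordered_ab_group_add) pval \<Rightarrow> bool" where
  "valuation \<nu> \<longleftrightarrow>
     (\<forall>f g. \<nu> (f * g) = \<nu> f + \<nu> g) \<and>
     (\<forall>f g. \<nu> (f + g) \<ge> min (\<nu> f) (\<nu> g)) \<and>
     \<nu> 1 = 0 \<and> \<nu> 0 = Infty"

text \<open>The \<open>q\<close>-expansion of \<open>f\<close>, as a polynomial in \<open>q\<close> with coefficients in \<open>K[x]\<close>: evaluating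
  it at \<open>q\<close> gives \<open>f\<close>. It is meaningful for nonconstant \<open>q\<close>; in that case the convention
  \<open>degree 0 = 0\<close> is harmless.\<close>

definition expansion :: "'k::field poly \<Rightarrow> 'k poly \<Rightarrow> 'k poly poly" where
  "expansion q f = (THE F. poly F q = f \<and> (\<forall>i. degree (coeff F i) < degree q))"

lemma expansion_exists_unique:
  fixes q f :: "'k::field poly"
  assumes "0 < degree q"
  shows "\<exists>!F. poly F q = f \<and> (\<forall>i. degree (coeff F i) < degree q)"
proof (rule ex_ex1I)
  show "\<exists>F. poly F q = f \<and> (\<forall>i. degree (coeff F i) < degree q)"
  proof (induction "degree f" arbitrary: f rule: less_induct)
    case less
    show ?case
    proof (cases "degree f < degree q")
      case True
      with assms show ?thesis
        by (intro exI [of _ "[:f:]"]) (auto simp: coeff_pCons split: nat.splits)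
    next
      case False
      with assms have "degree (f div q) < degree f"
        by (cases "f = 0") (auto simp: degree_div_less)
      from less [OF this] obtain G
        where G: "poly G q = f div q" "\<forall>i. degree (coeff G i) < degree q"
        by blast
      have "degree (f mod q) < degree q"
        using assms by (metis degree_0 degree_mod_less less_numeral_extra(3))
      with G show ?thesis
        by (intro exI [of _ "pCons (f mod q) G"])
          (auto simp: coeff_pCons mult.commute split: nat.splits)
    qed
  qed
next
  have "F = G"
    if "poly F q = poly G q" "\<forall>i. degree (coeff F i) < degree q" "\<forall>i. degree (coeff G i) < degree q"
    for F G :: "'k poly poly"
    using that
  proof (induction F arbitrary: G)
    case 0
    then show ?case
    proof (induction G)
      case (pCons b G)
      have b: "degree b < degree q" using pCons.prems(3) [rule_format, of 0] by simp
      have "b = - (q * poly G q)"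
        using pCons.prems(1) by (simp add: eq_neg_iff_add_eq_0)
      then have "q dvd b" by simp
      then have "b = 0" using b dvd_imp_degree_le by (metis linorder_not_le)
      moreover have "q \<noteq> 0" using assms by auto
      ultimately have "poly G q = 0" using \<open>b = - (q * poly G q)\<close> by simp
      moreover have "\<forall>i. degree (coeff G i) < degree q"
        using pCons.prems(3) by (metis coeff_pCons_Suc)
      ultimately show ?case using pCons.IH assms \<open>b = 0\<close> by simp
    qed simp
  next
    case (pCons a F)
    obtain b G' where G: "G = pCons b G'" by (cases G)
    have ab: "degree a < degree q" "degree b < degree q"
      using pCons.prems(2,3) [rule_format, of 0] by (simp_all add: G)
    have eq: "a - b = q * (poly G' q - poly F q)"
      using pCons.prems(1) by (simp add: G algebra_simps)
    have "degree (a - b) < degree q" using ab by (simp add: degree_diff_less)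
    moreover have "q dvd a - b" using eq by simp
    ultimately have "a - b = 0" using dvd_imp_degree_le by (metis linorder_not_le)
    moreover have "q \<noteq> 0" using assms by auto
    ultimately have "poly F q = poly G' q" using eq by simp
    moreover have "\<forall>i. degree (coeff F i) < degree q" "\<forall>i. degree (coeff G' i) < degree q"
      using pCons.prems(2,3) by (metis G coeff_pCons_Suc)+
    ultimately show ?case using pCons.IH \<open>a - b = 0\<close> by (simp add: G)
  qed
  then show "F = G"
    if "poly F q = f \<and> (\<forall>i. degree (coeff F i) < degree q)"
      "poly G q = f \<and> (\<forall>i. degree (coeff G i) < degree q)"
    for F G
    using that by blast
qed


section \<open>Key polynomials\<close>

text \<open>The Hasse derivative, in a form valid in every characteristic: \<open>x ^ i\<close> is sent to
  \<open>(i choose k) x ^ (i - k)\<close>.\<close>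

definition hasse_deriv :: "nat \<Rightarrow> 'k::field poly \<Rightarrow> 'k poly" where
  "hasse_deriv k f = (\<Sum>i\<in>{k..degree f}. monom (of_nat (i choose k) * coeff f i) (i - k))"

text \<open>\<open>(\<nu> f - \<nu> (\<partial>\<^sub>k f)) / k\<close>. An order \<open>k\<close> for which the derivative has value infinity does not
  contribute to the maximum. If \<open>\<nu> f\<close> is infinite and \<open>f \<noteq> 0\<close>, the derivative of order \<open>degree f\<close>
  is a nonzero constant, so \<open>eps \<nu> f = Pinf\<close>; constants have \<open>eps \<nu> f = Minf\<close>.\<close>

fun eps_quot :: "'g::linordered_ab_group_add vext \<Rightarrow> 'g vext \<Rightarrow> nat \<Rightarrow> 'g divhull extended" where
  "eps_quot (Val a) (Val b) k = Fin (divhull_frac (a - b) k)"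
| "eps_quot Infty (Val b) k = Pinf"
| "eps_quot a Infty k = Minf"

text \<open>Only finitely many terms of the maximum differ from \<open>Minf\<close>, so it is taken over a finite
  set of values; likewise for the minima over all \<open>i\<close> below, where almost all terms are \<open>Infty\<close>.\<close>

definition eps :: "('k::field, 'g::linordered_ab_group_add) pval \<Rightarrow> 'k poly \<Rightarrow> 'g divhull extended"
  where "eps \<nu> f = (MAX k\<in>{1..}. eps_quot (\<nu> f) (\<nu> (hasse_deriv k f)) k)"

text \<open>Key polynomials are nonconstant: \<open>\<epsilon>\<close> of a constant is not an element of the divisible hull
  and there is no expansion with respect to a constant.\<close>

definition key_poly :: "('k::field, 'g::linordered_ab_group_add) pval \<Rightarrow> 'k poly \<Rightarrow> bool" where
  "key_poly \<nu> Q \<longleftrightarrow> lead_coeff Q = 1 \<and> 0 < degree Q \<and>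
     (\<forall>f. eps \<nu> f \<ge> eps \<nu> Q \<longrightarrow> degree f \<ge> degree Q)"

definition truncation ::
  "('k::field, 'g::linordered_ab_group_add) pval \<Rightarrow> 'k poly \<Rightarrow> ('k, 'g) pval" where
  "truncation \<nu> Q f = (MIN i. \<nu> (coeff (expansion Q f) i * Q ^ i))"

definition alpha :: "('k::field, 'g::linordered_ab_group_add) pval \<Rightarrow> 'k poly \<Rightarrow> enat" where
  "alpha \<nu> Q = (INF f\<in>{f. truncation \<nu> Q f < \<nu> f}. enat (degree f))"

definition Psi :: "('k::field, 'g::linordered_ab_group_add) pval \<Rightarrow> 'k poly \<Rightarrow> 'k poly set" where
  "Psi \<nu> Q = {f. lead_coeff f = 1 \<and> truncation \<nu> Q f < \<nu> f \<and> enat (degree f) = alpha \<nu> Q}"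

definition no_maximal :: "'v::order set \<Rightarrow> bool" where
  "no_maximal S \<longleftrightarrow> \<not> (\<exists>m\<in>S. \<forall>s\<in>S. \<not> m < s)"

definition limit_key_poly ::
  "('k::field, 'g::linordered_ab_group_add) pval \<Rightarrow> 'k poly \<Rightarrow> 'k poly \<Rightarrow> bool" where
  "limit_key_poly \<nu> Q_minus Q \<longleftrightarrow>
     lead_coeff Q = 1 \<and> key_poly \<nu> Q_minus \<and>
     alpha \<nu> Q_minus = enat (degree Q_minus) \<and>
     no_maximal (\<nu> ` Psi \<nu> Q_minus) \<and>
     (\<forall>Q'\<in>Psi \<nu> Q_minus. truncation \<nu> Q' Q < \<nu> Q) \<and>
     (\<forall>f. (\<forall>Q'\<in>Psi \<nu> Q_minus. truncation \<nu> Q' f < \<nu> f) \<longrightarrow> degree Q \<le> degree f)"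


section \<open>MacLane--Vaquie key polynomials\<close>

definition val_ge :: "('k::field, 'g::linordered_ab_group_add) pval \<Rightarrow> 'g \<Rightarrow> 'k poly set" where
  "val_ge \<mu> \<gamma> = {a. \<mu> a \<ge> Val \<gamma>}"

definition val_gt :: "('k::field, 'g::linordered_ab_group_add) pval \<Rightarrow> 'g \<Rightarrow> 'k poly set" where
  "val_gt \<mu> \<gamma> = {a. \<mu> a > Val \<gamma>}"

text \<open>An element of the graded algebra is a family of cosets, the one with index \<open>\<gamma>\<close> belonging to
  \<open>val_ge \<mu> \<gamma> / val_gt \<mu> \<gamma>\<close>. The quotient is trivial if \<open>\<gamma>\<close> is not a value of \<open>\<mu>\<close>, so \<open>\<gamma>\<close> may run
  over the whole group. The initial form of \<open>a\<close> is homogeneous of degree \<open>\<mu> a\<close>, and it is zero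
  if \<open>\<mu> a\<close> is infinite.\<close>

definition init_form ::
  "('k::field, 'g::linordered_ab_group_add) pval \<Rightarrow> 'k poly \<Rightarrow> 'g \<Rightarrow> 'k poly set" where
  "init_form \<mu> a \<gamma> = (if \<mu> a = Val \<gamma> then {a + b | b. b \<in> val_gt \<mu> \<gamma>} else val_gt \<mu> \<gamma>)"

definition val_equiv ::
  "('k::field, 'g::linordered_ab_group_add) pval \<Rightarrow> 'k poly \<Rightarrow> 'k poly \<Rightarrow> bool" where
  "val_equiv \<mu> f g \<longleftrightarrow> init_form \<mu> f = init_form \<mu> g"

definition val_dvd ::
  "('k::field, 'g::linordered_ab_group_add) pval \<Rightarrow> 'k poly \<Rightarrow> 'k poly \<Rightarrow> bool" where
  "val_dvd \<mu> g f \<longleftrightarrow> (\<exists>h. val_equiv \<mu> f (g * h))"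

text \<open>The zero polynomial is divisible by everything; the degree conditions here and in
  \<open>limit_MLV_key_poly\<close> concern nonzero \<open>f\<close>.\<close>

definition MLV_key_poly :: "('k::field, 'g::linordered_ab_group_add) pval \<Rightarrow> 'k poly \<Rightarrow> bool" where
  "MLV_key_poly \<mu> P \<longleftrightarrow> lead_coeff P = 1 \<and>
     (\<forall>f g. val_dvd \<mu> P (f * g) \<longrightarrow> val_dvd \<mu> P f \<or> val_dvd \<mu> P g) \<and>
     (\<forall>f. f \<noteq> 0 \<longrightarrow> val_dvd \<mu> P f \<longrightarrow> degree f \<ge> degree P)"

text \<open>\<open>\<mu>' = [\<mu>; \<mu>'(P) = \<gamma>]\<close>. The group \<open>'g\<close> is an ambient one, in general larger than the value
  group of \<open>\<mu>\<close>; in this expression \<open>\<gamma>\<close> is a group element.\<close>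

definition augmentation ::
  "('k::field, 'g::linordered_ab_group_add) pval \<Rightarrow> 'k poly \<Rightarrow> 'g vext \<Rightarrow> ('k, 'g) pval \<Rightarrow> bool"
  where
  "augmentation \<mu> P \<gamma> \<mu>' \<longleftrightarrow> MLV_key_poly \<mu> P \<and> \<mu> P < \<gamma> \<and> \<gamma> \<noteq> Infty \<and>
     (\<forall>f. \<mu>' f = (MIN i. \<mu> (coeff (expansion P f) i) + nmult i \<gamma>))"


section \<open>Families of augmented valuations\<close>

text \<open>A family \<open>{(V \<alpha>, Q \<alpha>, \<gamma> \<alpha>)}\<close> is indexed by a set \<open>A\<close> with a strict ordering \<open>lt\<close>. Distinct
  indices are allowed to be incomparable (for \<open>A = Psi \<nu> Q\<close> ordered by \<open>\<epsilon>\<close>, distinct polynomials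
  may have the same \<open>\<epsilon>\<close>), but incomparability is transitive, i.e. \<open>A\<close> is totally ordered up to
  ties. Accordingly, \<open>\<alpha> \<ge> \<beta>\<close> means that \<open>\<alpha> < \<beta>\<close> does not hold. If any two distinct elements are
  comparable, these notions are the usual ones for a totally ordered set.\<close>

definition total_order_with_ties :: "'i set \<Rightarrow> ('i \<Rightarrow> 'i \<Rightarrow> bool) \<Rightarrow> bool" where
  "total_order_with_ties A lt \<longleftrightarrow>
     (\<forall>a\<in>A. \<forall>b\<in>A. lt a b \<longrightarrow> \<not> lt b a) \<and>
     (\<forall>a\<in>A. \<forall>b\<in>A. \<forall>c\<in>A. lt a c \<longrightarrow> lt a b \<or> lt b c)"

definition smallest :: "'i set \<Rightarrow> ('i \<Rightarrow> 'i \<Rightarrow> bool) \<Rightarrow> 'i \<Rightarrow> bool" where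
  "smallest A lt a \<longleftrightarrow> a \<in> A \<and> (\<forall>b\<in>A. \<not> lt b a)"

definition immediate_pred :: "'i set \<Rightarrow> ('i \<Rightarrow> 'i \<Rightarrow> bool) \<Rightarrow> 'i \<Rightarrow> 'i \<Rightarrow> bool" where
  "immediate_pred A lt b a \<longleftrightarrow> b \<in> A \<and> lt b a \<and> \<not> (\<exists>c\<in>A. lt b c \<and> lt c a)"

definition augmented_family ::
  "'i set \<Rightarrow> ('i \<Rightarrow> 'i \<Rightarrow> bool) \<Rightarrow>
   ('i \<Rightarrow> ('k::field, 'g::linordered_ab_group_add) pval) \<Rightarrow> ('i \<Rightarrow> 'k poly) \<Rightarrow> ('i \<Rightarrow> 'g vext) \<Rightarrow> bool"
  where
  "augmented_family A lt V Q \<gamma> \<longleftrightarrow>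
     total_order_with_ties A lt \<and>
     (\<forall>a\<in>A. valuation (V a) \<and> \<gamma> a \<noteq> Infty) \<and>
     (\<forall>a\<in>A. \<not> smallest A lt a \<longrightarrow>
        (\<exists>a'\<in>A. lt a' a \<and> augmentation (V a') (Q a) (\<gamma> a) (V a) \<and>
           (if \<exists>b. immediate_pred A lt b a
            then immediate_pred A lt a' a \<and>
              (\<not> smallest A lt a' \<longrightarrow>
                 \<not> val_equiv (V a') (Q a) (Q a') \<and> degree (Q a') \<le> degree (Q a))
            else
              (\<forall>b\<in>A. lt a' b \<and> lt b a \<longrightarrow>
                 augmentation (V a') (Q b) (\<gamma> b) (V b) \<and>
                 augmentation (V b) (Q a) (\<gamma> a) (V a)) \<and>
              degree (Q a) = degree (Q a'))))"

definition continued_family ::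
  "'i set \<Rightarrow> ('i \<Rightarrow> 'i \<Rightarrow> bool) \<Rightarrow>
   ('i \<Rightarrow> ('k::field, 'g::linordered_ab_group_add) pval) \<Rightarrow> ('i \<Rightarrow> 'k poly) \<Rightarrow> ('i \<Rightarrow> 'g vext) \<Rightarrow> bool"
  where
  "continued_family A lt V Q \<gamma> \<longleftrightarrow>
     augmented_family A lt V Q \<gamma> \<and>
     no_maximal (\<gamma> ` A) \<and>
     (\<forall>a\<in>A. \<forall>b\<in>A. degree (Q a) = degree (Q b)) \<and>
     (\<exists>\<mu>. valuation \<mu> \<and> (\<forall>a\<in>A. augmentation \<mu> (Q a) (\<gamma> a) (V a)))"

definition family_dvd ::
  "'i set \<Rightarrow> ('i \<Rightarrow> 'i \<Rightarrow> bool) \<Rightarrow> ('i \<Rightarrow> ('k::field, 'g::linordered_ab_group_add) pval) \<Rightarrow>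
   'k poly \<Rightarrow> 'k poly \<Rightarrow> bool" where
  "family_dvd A lt V f g \<longleftrightarrow> (\<exists>a0\<in>A. \<forall>a\<in>A. \<not> lt a a0 \<longrightarrow> val_dvd (V a) f g)"

definition limit_MLV_key_poly ::
  "'i set \<Rightarrow> ('i \<Rightarrow> 'i \<Rightarrow> bool) \<Rightarrow> ('i \<Rightarrow> ('k::field, 'g::linordered_ab_group_add) pval) \<Rightarrow>
   'k poly \<Rightarrow> bool" where
  "limit_MLV_key_poly A lt V Q \<longleftrightarrow> lead_coeff Q = 1 \<and>
     (\<forall>f g. family_dvd A lt V Q (f * g) \<longrightarrow> family_dvd A lt V Q f \<or> family_dvd A lt V Q g) \<and>
     (\<forall>f. f \<noteq> 0 \<longrightarrow> family_dvd A lt V Q f \<longrightarrow> degree Q \<le> degree f)"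

definition stable_value ::
  "'i set \<Rightarrow> ('i \<Rightarrow> 'i \<Rightarrow> bool) \<Rightarrow> ('i \<Rightarrow> ('k::field, 'g::linordered_ab_group_add) pval) \<Rightarrow>
   'k poly \<Rightarrow> 'g vext \<Rightarrow> bool" where
  "stable_value A lt V f v \<longleftrightarrow>
     (\<exists>a0\<in>A. v = V a0 f \<and> (\<forall>a\<in>A. \<not> lt a a0 \<longrightarrow> V a f = V a0 f))"

text \<open>Meaningful only for those \<open>f\<close> that have a stable value.\<close>

definition family_val ::
  "'i set \<Rightarrow> ('i \<Rightarrow> 'i \<Rightarrow> bool) \<Rightarrow> ('i \<Rightarrow> ('k::field, 'g::linordered_ab_group_add) pval) \<Rightarrow>
   ('k, 'g) pval" where
  "family_val A lt V f = (THE v. stable_value A lt V f v)"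

text \<open>\<open>\<nu>' = [\<nu>\<^sub>F; \<nu>'(Q) = \<gamma>]\<close>. It is part of the assertion that the values of the family at the
  coefficients of the expansions with respect to \<open>Q\<close> are defined. Here \<open>\<gamma>\<close> may be infinite, as
  is the case for \<open>\<gamma> = \<nu> Q\<close> when \<open>Q\<close> lies in the support of \<open>\<nu>\<close>.\<close>

definition limit_augmentation ::
  "'i set \<Rightarrow> ('i \<Rightarrow> 'i \<Rightarrow> bool) \<Rightarrow> ('i \<Rightarrow> ('k::field, 'g::linordered_ab_group_add) pval) \<Rightarrow>
   'k poly \<Rightarrow> 'g vext \<Rightarrow> ('k, 'g) pval \<Rightarrow> bool" where
  "limit_augmentation A lt V Q \<gamma> \<nu>' \<longleftrightarrow>
     (\<forall>a\<in>A. V a Q < \<gamma>) \<and>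
     (\<forall>f i. \<exists>v. stable_value A lt V (coeff (expansion Q f) i) v) \<and>
     (\<forall>f. \<nu>' f = (MIN i. family_val A lt V (coeff (expansion Q f) i) + nmult i \<gamma>))"

end

theory Submission
  imports Defs
begin

text \<open>The set \<open>\<Psi> = Psi \<nu> Q_minus\<close> consists of the monic polynomials \<open>P\<close> of the degree of
  \<open>Q_minus\<close> with \<open>\<nu> Q_minus < \<nu> P\<close> (\<open>Psi_iff\<close>), and on it the order by \<open>\<epsilon>\<close> is the order by \<open>\<nu>\<close>
  (\<open>prec_iff\<close>). Apart from this, \<open>\<epsilon>\<close> enters only through one property of key polynomials \<open>P\<close>: if
  \<open>a\<close> and \<open>b\<close> are nonzero of degree less than \<open>degree P\<close> and \<open>a * b = l * P + r\<close> is the division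
  with remainder, then \<open>\<nu> (a * b) < \<nu> (l * P)\<close> (\<open>key_poly_division\<close>). Indeed \<open>\<epsilon>\<close> is smaller
  than \<open>\<epsilon> P\<close> on \<open>a * b\<close> and on \<open>r\<close>, whereas the Hasse derivative of some order shows that
  \<open>l * P\<close> does reach \<open>\<epsilon> P\<close>; so \<open>l * P\<close> cannot dominate in \<open>a * b - r\<close>. The property makes
  the truncation \<open>\<nu>\<^sub>P\<close> a valuation (\<open>truncation_mult\<close>), and for \<open>P\<close> of a fixed degree \<open>\<nu>\<^sub>P\<close>
  increases with \<open>\<nu> P\<close> (\<open>truncation_mono\<close>).

  Divisibility of initial forms is an increase of values: let \<open>\<mu> \<le> \<mu>'\<close> be valuations that agree
  below \<open>degree P\<close>, with \<open>\<mu> P < \<mu>' P\<close>, and suppose that \<open>\<mu>' f \<le> \<mu>' (f mod P)\<close> for all \<open>f\<close>. Then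
  \<open>P\<close> divides \<open>f\<close> up to \<open>\<mu>\<close>-equivalence if and only if \<open>\<mu> f < \<mu>' f\<close> (\<open>val_dvd_iff\<close>). In this form
  both axioms of a MacLane--Vaquie key polynomial are evident, the first because \<open>\<mu>\<close> and \<open>\<mu>'\<close> are
  multiplicative. With truncations for \<open>\<mu>\<close> and \<open>\<mu>'\<close> one obtains that \<open>\<nu>\<^sub>P\<^sub>'\<close> is an augmentation
  of \<open>\<nu>\<^sub>P\<close> whenever \<open>\<nu> P < \<nu> P'\<close> (\<open>truncation_augmentation\<close>). This includes \<open>P = Q_minus\<close>, whose
  truncation is thus the valuation from which the whole continued family is obtained.

  Finally, a polynomial \<open>f\<close> of degree less than \<open>degree Q\<close> satisfies \<open>\<nu>\<^sub>P f = \<nu> f\<close> for all large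
  \<open>P\<close> in \<open>\<Psi>\<close>, by the minimality of \<open>degree Q\<close>. So the limit of the family is \<open>\<nu>\<close> on the coefficients
  of \<open>Q\<close>-expansions, which gives the description of \<open>\<nu>\<^sub>Q\<close>; and the argument of \<open>val_dvd_iff\<close>, with
  \<open>\<nu>\<close> in the place of \<open>\<mu>'\<close>, shows that \<open>Q\<close> divides \<open>f \<noteq> 0\<close> along the family if and only if
  \<open>\<nu>\<^sub>P f < \<nu> f\<close> for all \<open>P\<close> in \<open>\<Psi>\<close> (\<open>family_dvd_iff\<close>), whence \<open>Q\<close> is a limit key
  polynomial in the sense of MacLane and Vaquie.\<close>


section \<open>Arithmetic of values\<close>

lemma vext_le_Infty [simp]: "x \<le> (Infty :: 'a::linorder vext)"
  by (cases x) auto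

lemma Infty_le_iff [simp]: "(Infty :: 'a::linorder vext) \<le> x \<longleftrightarrow> x = Infty"
  by (cases x) auto

lemma Val_less_Val [simp]: "Val x < Val y \<longleftrightarrow> x < (y :: 'a::linorder)"
  by (auto simp: less_vext_def)

lemma less_Infty_iff [simp]: "x < (Infty :: 'a::linorder vext) \<longleftrightarrow> x \<noteq> Infty"
  by (cases x) (auto simp: less_vext_def)

lemma not_Infty_less [simp]: "\<not> (Infty :: 'a::linorder vext) < x"
  by (simp add: less_vext_def)

lemma less_imp_not_Infty: "x < y \<Longrightarrow> x \<noteq> (Infty :: 'a::linorder vext)"
  by auto

lemma add_Infty_right [simp]: "x + Infty = (Infty :: 'a::comm_monoid_add vext)"
  by (cases x) auto

lemma add_eq_Infty_iff [simp]:
  "x + y = (Infty :: 'a::comm_monoid_add vext) \<longleftrightarrow> x = Infty \<or> y = Infty"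
  by (cases x; cases y) auto

lemma zero_not_Infty [simp]:
  "0 \<noteq> (Infty :: 'a::comm_monoid_add vext)" "Infty \<noteq> (0 :: 'a::comm_monoid_add vext)"
  by (simp_all add: zero_vext_def)

instance vext :: (linordered_ab_group_add) ordered_comm_monoid_add
proof
  fix a b c :: "'a vext"
  show "a \<le> b \<Longrightarrow> c + a \<le> c + b" by (cases a; cases b; cases c) auto
qed

lemma vext_add_less_le_mono:
  fixes x y :: "'a::linordered_ab_group_add vext"
  assumes "x < y" "x' \<le> y'" "x' \<noteq> Infty"
  shows "x + x' < y + y'"
  using assms by (cases x; cases y; cases x'; cases y') (auto intro: add_less_le_mono)

lemma vext_add_le_less_mono:
  fixes x y :: "'a::linordered_ab_group_add vext"
  assumes "x' \<le> y'" "x < y" "x' \<noteq> Infty"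
  shows "x' + x < y' + y"
  using vext_add_less_le_mono[OF assms(2,1,3)] by (simp add: add.commute)

lemma vext_add_less_cancel [simp]:
  fixes x y :: "'a::linordered_ab_group_add vext"
  assumes "z \<noteq> Infty"
  shows "z + x < z + y \<longleftrightarrow> x < y"
  using assms by (cases x; cases y; cases z) auto

lemma nmult_add: "nmult k (x + y) = nmult k x + nmult k (y :: 'm::comm_monoid_add)"
  by (induction k) (auto simp: ac_simps)

lemma nmult_add_left: "nmult (i + j) x = nmult i x + nmult j (x :: 'm::comm_monoid_add)"
  by (induction i) (auto simp: ac_simps)

lemma nmult_zero [simp]: "nmult k (0 :: 'm::comm_monoid_add) = 0"
  by (induction k) auto

lemma nmult_Val: "nmult k (Val a) = Val (nmult k a)"
  by (induction k) (auto simp: zero_vext_def)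

lemma nmult_Infty: "0 < k \<Longrightarrow> nmult k Infty = Infty"
  by (cases k) auto

lemma nmult_eq_Infty_iff: "nmult k x = Infty \<longleftrightarrow> 0 < k \<and> x = Infty"
  by (cases k; cases x) (auto simp: nmult_Val)

lemma nmult_mono: "x \<le> y \<Longrightarrow> nmult k x \<le> nmult k (y :: 'm::ordered_comm_monoid_add)"
  by (induction k) (auto intro: add_mono)

lemma nmult_less_iff:
  fixes x y :: "'a::linordered_ab_group_add vext"
  assumes "0 < k"
  shows "nmult k x < nmult k y \<longleftrightarrow> x < y"
proof -
  obtain n where k: "k = Suc n" using assms gr0_implies_Suc by blast
  show ?thesis
    using strict_mono_less[OF nmult_Suc_strict_mono[where 'g = 'a], of n]
    by (cases x; cases y)
      (auto simp: k nmult_Val nmult_Infty simp del: nmult.simps)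
qed

lemma nmult_le_iff:
  fixes x y :: "'a::linordered_ab_group_add vext"
  assumes "0 < k"
  shows "nmult k x \<le> nmult k y \<longleftrightarrow> x \<le> y"
  using nmult_less_iff[OF assms, of y x] by (simp add: not_less [symmetric])

lemma nmult_diff:
  "nmult k (a - b) = nmult k a - nmult k (b :: 'a::ab_group_add)"
  by (induction k) (auto simp: algebra_simps)


section \<open>Valuations\<close>

locale poly_valuation =
  fixes \<nu> :: "('k::field, 'g::linordered_ab_group_add) pval"
  assumes valuation: "valuation \<nu>"
begin

lemma val_mult: "\<nu> (f * g) = \<nu> f + \<nu> g"
  and val_add: "min (\<nu> f) (\<nu> g) \<le> \<nu> (f + g)"
  and val_one [simp]: "\<nu> 1 = 0"
  and val_zero [simp]: "\<nu> 0 = Infty"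
  using valuation by (auto simp: valuation_def)

lemma val_const_finite: "c \<noteq> 0 \<Longrightarrow> \<nu> [:c:] \<noteq> Infty"
  using val_mult[of "[:c:]" "[:inverse c:]"] by (auto simp: one_pCons[symmetric])

lemma val_power: "\<nu> (f ^ k) = nmult k (\<nu> f)"
  by (induction k) (auto simp: val_mult)

text \<open>In an ordered group \<open>2 \<cdot> \<nu> (-1) = \<nu> 1 = 0\<close> forces \<open>\<nu> (-1) = 0\<close>.\<close>

lemma val_minus [simp]: "\<nu> (- f) = \<nu> f"
proof -
  have "\<nu> (- 1) + \<nu> (- 1) = 0" using val_mult[of "-1" "-1"] by simp
  then have "\<nu> (- 1) = 0" by (cases "\<nu> (- 1)") (auto simp: zero_vext_def)
  then show ?thesis using val_mult[of "-1" f] by simp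
qed

lemma val_diff: "min (\<nu> f) (\<nu> g) \<le> \<nu> (f - g)"
  using val_add[of f "- g"] by simp

lemma val_ge_add: "\<gamma> \<le> \<nu> f \<Longrightarrow> \<gamma> \<le> \<nu> g \<Longrightarrow> \<gamma> \<le> \<nu> (f + g)"
  using val_add[of f g] by (meson min.boundedI order_trans)

lemma val_ge_diff: "\<gamma> \<le> \<nu> f \<Longrightarrow> \<gamma> \<le> \<nu> g \<Longrightarrow> \<gamma> \<le> \<nu> (f - g)"
  using val_diff[of f g] by (meson min.boundedI order_trans)

lemma val_gt_add: "\<gamma> < \<nu> f \<Longrightarrow> \<gamma> < \<nu> g \<Longrightarrow> \<gamma> < \<nu> (f + g)"
  using val_add[of f g] by (meson min_less_iff_conj order.strict_trans2)

lemma val_gt_diff: "\<gamma> < \<nu> f \<Longrightarrow> \<gamma> < \<nu> g \<Longrightarrow> \<gamma> < \<nu> (f - g)"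
  using val_diff[of f g] by (meson min_less_iff_conj order.strict_trans2)

lemma val_add_eq: 
  assumes "\<nu> f < \<nu> g"
  shows "\<nu> (f + g) = \<nu> f"
proof (rule antisym)
  show "\<nu> f \<le> \<nu> (f + g)" using assms by (intro val_ge_add) auto
  show "\<nu> (f + g) \<le> \<nu> f"
    using val_gt_diff[of "\<nu> f" "f + g" g] assms by (auto simp: not_less[symmetric])
qed

lemma val_sum_ge:
  assumes "\<And>i. i \<in> I \<Longrightarrow> \<gamma> \<le> \<nu> (t i)"
  shows "\<gamma> \<le> \<nu> (sum t I)"
  using assms by (induction I rule: infinite_finite_induct) (auto intro: val_ge_add)

lemma val_sum_gt:
  assumes "\<gamma> \<noteq> Infty" "\<And>i. i \<in> I \<Longrightarrow> \<gamma> < \<nu> (t i)"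
  shows "\<gamma> < \<nu> (sum t I)"
  using assms(2) by (induction I rule: infinite_finite_induct) (auto simp: assms(1) intro: val_gt_add)

text \<open>This clears the denominator of a bound \<open>c / k\<close> on \<open>\<epsilon>\<close>: with respect to the valuation
  \<open>k \<cdot> \<nu>\<close> the bound becomes the group element \<open>c\<close>.\<close>

lemma valuation_multiple:
  assumes "0 < k"
  shows "poly_valuation (\<lambda>f. nmult k (\<nu> f))"
proof
  have "min (nmult k x) (nmult k y) = nmult k (min x y)" for x y :: "'g vext"
    by (simp add: min_def nmult_le_iff[OF assms])
  then show "valuation (\<lambda>f. nmult k (\<nu> f))"
    using assms by (simp add: valuation_def val_mult nmult_add nmult_Infty nmult_mono val_add)
qed

end


section \<open>Hasse derivatives\<close>

lemma coeff_hasse_deriv: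
  "coeff (hasse_deriv k f) j = of_nat ((j + k) choose k) * coeff f (j + k)"
proof -
  have "coeff (hasse_deriv k f) j =
      (\<Sum>i\<in>{k..degree f}. if i = j + k then of_nat (i choose k) * coeff f i else 0)"
    unfolding hasse_deriv_def coeff_sum by (intro sum.cong) auto
  then show ?thesis by (auto simp: coeff_eq_0)
qed

lemma hasse_deriv_0 [simp]: "hasse_deriv 0 f = f"
  by (rule poly_eqI) (simp add: coeff_hasse_deriv)

lemma hasse_deriv_zero [simp]: "hasse_deriv k 0 = 0"
  by (rule poly_eqI) (simp add: coeff_hasse_deriv)

lemma hasse_deriv_add: "hasse_deriv k (f + g) = hasse_deriv k f + hasse_deriv k g"
  by (rule poly_eqI) (simp add: coeff_hasse_deriv algebra_simps)

lemma hasse_deriv_smult: "hasse_deriv k (smult c f) = smult c (hasse_deriv k f)"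
  by (rule poly_eqI) (simp add: coeff_hasse_deriv algebra_simps)

lemma hasse_deriv_eq_0: "degree f < k \<Longrightarrow> hasse_deriv k f = 0"
  by (rule poly_eqI) (simp add: coeff_hasse_deriv coeff_eq_0)

lemma hasse_deriv_degree: "hasse_deriv (degree f) f = [:lead_coeff f:]"
proof (rule poly_eqI)
  fix j
  show "coeff (hasse_deriv (degree f) f) j = coeff [:lead_coeff f:] j"
    by (cases j) (simp_all add: coeff_hasse_deriv coeff_eq_0)
qed

lemma hasse_deriv_pCons:
  "hasse_deriv (Suc k) (pCons c f) = pCons 0 (hasse_deriv (Suc k) f) + hasse_deriv k f"
  by (rule poly_eqI)
    (auto simp: coeff_hasse_deriv coeff_pCons binomial_eq_0 algebra_simps split: nat.splits)

lemma hasse_deriv_diff: "hasse_deriv k (f - g) = hasse_deriv k f - hasse_deriv k g"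
  by (rule poly_eqI) (simp add: coeff_hasse_deriv algebra_simps)

theorem hasse_deriv_mult:
  "hasse_deriv k (f * g) = (\<Sum>i\<le>k. hasse_deriv i f * hasse_deriv (k - i) g)"
proof (induction f arbitrary: k)
  case 0
  then show ?case by simp
next
  case (pCons c f)
  show ?case
  proof (cases k)
    case (Suc m)
    have "hasse_deriv k (pCons c f * g)
        = smult c (hasse_deriv k g) + (pCons 0 (hasse_deriv k (f * g)) + hasse_deriv m (f * g))"
      by (simp add: Suc hasse_deriv_add hasse_deriv_smult hasse_deriv_pCons)
    also have "\<dots> = smult c (hasse_deriv k g)
        + (pCons 0 (f * hasse_deriv k g
              + (\<Sum>i\<le>m. hasse_deriv (Suc i) f * hasse_deriv (m - i) g))
           + (\<Sum>i\<le>m. hasse_deriv i f * hasse_deriv (m - i) g))"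
      by (simp add: pCons.IH Suc sum.atMost_Suc_shift del: sum.atMost_Suc)
    also have "\<dots> = pCons c f * hasse_deriv k g
        + (\<Sum>i\<le>m. hasse_deriv (Suc i) (pCons c f) * hasse_deriv (m - i) g)"
      (is "?l = ?r")
    proof -
      have X: "pCons 0 h = [:0, 1:] * h" for h :: "'a poly" by simp
      have "?r = pCons c f * hasse_deriv k g
        + ([:0, 1:] * (\<Sum>i\<le>m. hasse_deriv (Suc i) f * hasse_deriv (m - i) g)
        + (\<Sum>i\<le>m. hasse_deriv i f * hasse_deriv (m - i) g))"
        unfolding hasse_deriv_pCons X[of "hasse_deriv _ f"]
        by (simp only: ring_distribs sum.distrib sum_distrib_left mult.assoc)
      then show ?thesis by (simp add: algebra_simps)
    qed
    also have "\<dots> = (\<Sum>i\<le>k. hasse_deriv i (pCons c f) * hasse_deriv (k - i) g)"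
      by (simp add: Suc sum.atMost_Suc_shift del: sum.atMost_Suc)
    finally show ?thesis .
  qed simp
qed


section \<open>The slope of a polynomial\<close>

context poly_valuation
begin

text \<open>For the valuation \<open>k \<cdot> \<nu>\<close> in the place of \<open>\<nu>\<close>, and \<open>\<delta> = Val c\<close>, these are the inequalities
  \<open>\<epsilon> f < c / k\<close> and \<open>\<epsilon> f \<le> c / k\<close> for \<open>f\<close> of finite value, freed of denominators and of differences of possibly infinite
  values.\<close>

definition slope_less :: "'g vext \<Rightarrow> 'k poly \<Rightarrow> bool" where
  "slope_less \<delta> f \<longleftrightarrow> (\<forall>i>0. \<nu> f < \<nu> (hasse_deriv i f) + nmult i \<delta>)"

definition slope_le :: "'g vext \<Rightarrow> 'k poly \<Rightarrow> bool" where
  "slope_le \<delta> f \<longleftrightarrow> (\<forall>i>0. \<nu> f \<le> \<nu> (hasse_deriv i f) + nmult i \<delta>)"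

lemma slope_le_all: "slope_le \<delta> f \<Longrightarrow> \<nu> f \<le> \<nu> (hasse_deriv i f) + nmult i \<delta>"
  by (cases "i = 0") (auto simp: slope_le_def)

lemma slope_less_imp_le: "slope_less \<delta> f \<Longrightarrow> slope_le \<delta> f"
  by (auto simp: slope_le_def slope_less_def less_imp_le)

lemma val_add_cases:
  obtains "\<nu> f \<le> \<nu> (f + g)" | "\<nu> g \<le> \<nu> (f + g)"
  using val_add[of f g] by (auto simp: min_def split: if_splits)

lemma val_gt_add_shift:
  "\<gamma> < \<nu> f + d \<Longrightarrow> \<gamma> < \<nu> g + d \<Longrightarrow> \<gamma> < \<nu> (f + g) + d"
  by (rule val_add_cases[of f g]) (blast intro: add_right_mono order.strict_trans2)+

lemma val_gt_diff_shift:
  "\<gamma> < \<nu> f + d \<Longrightarrow> \<gamma> < \<nu> g + d \<Longrightarrow> \<gamma> < \<nu> (f - g) + d"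
  using val_gt_add_shift[of \<gamma> f d "- g"] by simp

lemma val_ge_add_shift:
  "\<gamma> \<le> \<nu> f + d \<Longrightarrow> \<gamma> \<le> \<nu> g + d \<Longrightarrow> \<gamma> \<le> \<nu> (f + g) + d"
  by (rule val_add_cases[of f g]) (blast intro: add_right_mono order.trans)+

lemma val_sum_gt_shift:
  assumes "\<gamma> \<noteq> Infty" "\<And>i. i \<in> I \<Longrightarrow> \<gamma> < \<nu> (t i) + d"
  shows "\<gamma> < \<nu> (sum t I) + d"
  using assms(2)
  by (induction I rule: infinite_finite_induct) (auto simp: assms(1) intro: val_gt_add_shift)

text \<open>In every term of the Leibniz formula for a derivative of positive order, at least one factor
  is differentiated, and contributes a strict inequality.\<close>

lemma slope_less_mult:
  assumes "\<delta> \<noteq> Infty" "\<nu> f \<noteq> Infty" "\<nu> g \<noteq> Infty" "slope_less \<delta> f" "slope_less \<delta> g"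
  shows "slope_less \<delta> (f * g)"
  unfolding slope_less_def
proof (intro allI impI)
  fix i :: nat
  assume "0 < i"
  show "\<nu> (f * g) < \<nu> (hasse_deriv i (f * g)) + nmult i \<delta>"
    unfolding hasse_deriv_mult
  proof (rule val_sum_gt_shift)
    show "\<nu> (f * g) \<noteq> Infty" using assms by (simp add: val_mult)
  next
    fix j assume j: "j \<in> {..i}"
    have f: "\<nu> f \<le> \<nu> (hasse_deriv j f) + nmult j \<delta>"
      and g: "\<nu> g \<le> \<nu> (hasse_deriv (i - j) g) + nmult (i - j) \<delta>"
      using assms by (auto intro: slope_le_all slope_less_imp_le)
    have "\<nu> f + \<nu> g < (\<nu> (hasse_deriv j f) + nmult j \<delta>)
        + (\<nu> (hasse_deriv (i - j) g) + nmult (i - j) \<delta>)"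
    proof (cases "j = 0")
      case True
      with \<open>0 < i\<close> show ?thesis
        using assms f by (intro vext_add_le_less_mono) (auto simp: slope_less_def)
    next
      case False
      then show ?thesis
        using assms g by (intro vext_add_less_le_mono) (auto simp: slope_less_def)
    qed
    also have "\<dots> = \<nu> (hasse_deriv j f * hasse_deriv (i - j) g) + nmult i \<delta>"
      using nmult_add_left[of j "i - j" \<delta>] j by (simp add: val_mult ac_simps)
    finally show "\<nu> (f * g) < \<nu> (hasse_deriv j f * hasse_deriv (i - j) g) + nmult i \<delta>"
      by (simp add: val_mult)
  qed
qed

text \<open>In the Leibniz formula for \<open>l * P\<close> the term in which only \<open>P\<close> is differentiated has a strictly
  smaller value than all others, so that it cannot be cancelled.\<close>

lemma slope_attained_mult:
  assumes "\<delta> \<noteq> Infty" "\<nu> l \<noteq> Infty" "\<nu> P \<noteq> Infty" "slope_less \<delta> l" "slope_le \<delta> P"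
    and att: "\<nu> P = \<nu> (hasse_deriv j P) + nmult j \<delta>"
  shows "\<nu> (hasse_deriv j (l * P)) + nmult j \<delta> = \<nu> (l * P)"
proof -
  define R where "R = (\<Sum>i\<in>{..j} - {0}. hasse_deriv i l * hasse_deriv (j - i) P)"
  have split: "hasse_deriv j (l * P) = l * hasse_deriv j P + R"
    unfolding hasse_deriv_mult R_def by (subst sum.remove[of _ 0]) auto
  have lead: "\<nu> (l * hasse_deriv j P) + nmult j \<delta> = \<nu> (l * P)"
    by (simp add: val_mult att add.assoc)
  have "\<nu> (l * P) < \<nu> R + nmult j \<delta>"
    unfolding R_def
  proof (rule val_sum_gt_shift)
    show "\<nu> (l * P) \<noteq> Infty" using assms by (simp add: val_mult)
  next
    fix i assume i: "i \<in> {..j} - {0}"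
    have "\<nu> l + \<nu> P < (\<nu> (hasse_deriv i l) + nmult i \<delta>)
        + (\<nu> (hasse_deriv (j - i) P) + nmult (j - i) \<delta>)"
      using assms i
      by (intro vext_add_less_le_mono slope_le_all) (auto simp: slope_less_def)
    also have "\<dots> = \<nu> (hasse_deriv i l * hasse_deriv (j - i) P) + nmult j \<delta>"
      using nmult_add_left[of i "j - i" \<delta>] i by (simp add: val_mult ac_simps)
    finally show "\<nu> (l * P) < \<nu> (hasse_deriv i l * hasse_deriv (j - i) P) + nmult j \<delta>"
      by (simp add: val_mult)
  qed
  then have "nmult j \<delta> + \<nu> (l * hasse_deriv j P) < nmult j \<delta> + \<nu> R"
    using lead by (simp add: add.commute)
  then have "\<nu> (l * hasse_deriv j P) < \<nu> R"
    using assms(1) by (simp add: nmult_eq_Infty_iff)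
  then have "\<nu> (hasse_deriv j (l * P)) = \<nu> (l * hasse_deriv j P)"
    unfolding split by (rule val_add_eq)
  with lead show ?thesis by simp
qed

end


section \<open>Slopes and the invariant epsilon\<close>

lemma divhull_frac_le_iff:
  assumes "0 < i" "0 < k"
  shows "divhull_frac a i \<le> divhull_frac b k \<longleftrightarrow> nmult k a \<le> nmult i b"
proof -
  have "divhull_frac a i \<le> divhull_frac b k \<longleftrightarrow> nmult (Suc (k - 1)) a \<le> nmult (Suc (i - 1)) b"
    by transfer (simp add: frac_le_def)
  then show ?thesis using assms by simp
qed

lemma divhull_frac_less_iff:
  assumes "0 < i" "0 < k"
  shows "divhull_frac a i < divhull_frac b k \<longleftrightarrow> nmult k a < nmult i b"
  unfolding not_le[symmetric] using divhull_frac_le_iff[OF assms(2,1)] by blast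

lemma eps_quot_le_iff:
  assumes "0 < i" "0 < k"
  shows "eps_quot (Val a) y i \<le> Fin (divhull_frac c k) \<longleftrightarrow>
    nmult k (Val a) \<le> nmult k y + nmult i (Val c)"
  using assms
  by (cases y) (simp_all add: divhull_frac_le_iff nmult_Val nmult_Infty nmult_diff diff_le_eq add.commute)

lemma eps_quot_less_iff:
  assumes "0 < i" "0 < k"
  shows "eps_quot (Val a) y i < Fin (divhull_frac c k) \<longleftrightarrow>
    nmult k (Val a) < nmult k y + nmult i (Val c)"
  using assms
  by (cases y)
    (simp_all add: divhull_frac_less_iff nmult_Val nmult_Infty nmult_diff diff_less_eq add.commute)

context poly_valuation
begin

lemma finite_eps_quots: "finite ((\<lambda>k. eps_quot (\<nu> f) (\<nu> (hasse_deriv k f)) k) ` {1..})"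
proof (rule finite_subset)
  show "(\<lambda>k. eps_quot (\<nu> f) (\<nu> (hasse_deriv k f)) k) ` {1..} \<subseteq>
      insert Minf ((\<lambda>k. eps_quot (\<nu> f) (\<nu> (hasse_deriv k f)) k) ` {..degree f})"
  proof (rule image_subsetI)
    fix k
    show "eps_quot (\<nu> f) (\<nu> (hasse_deriv k f)) k \<in>
        insert Minf ((\<lambda>k. eps_quot (\<nu> f) (\<nu> (hasse_deriv k f)) k) ` {..degree f})"
      by (cases "degree f < k") (auto simp: hasse_deriv_eq_0)
  qed
qed simp

lemma eps_le_iff: "eps \<nu> f \<le> e \<longleftrightarrow> (\<forall>k>0. eps_quot (\<nu> f) (\<nu> (hasse_deriv k f)) k \<le> e)"
  using finite_eps_quots[of f] unfolding eps_def by (subst Max_le_iff) (auto simp: Suc_le_eq)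

lemma eps_less_iff: "eps \<nu> f < e \<longleftrightarrow> (\<forall>k>0. eps_quot (\<nu> f) (\<nu> (hasse_deriv k f)) k < e)"
  using finite_eps_quots[of f] unfolding eps_def by (subst Max_less_iff) (auto simp: Suc_le_eq)

lemma eps_attained:
  obtains k where "0 < k" "eps \<nu> f = eps_quot (\<nu> f) (\<nu> (hasse_deriv k f)) k"
proof -
  have "eps \<nu> f \<in> (\<lambda>k. eps_quot (\<nu> f) (\<nu> (hasse_deriv k f)) k) ` {1..}"
    unfolding eps_def by (rule Max_in[OF finite_eps_quots]) auto
  then show ?thesis using that by (elim imageE) (simp add: Suc_le_eq)
qed

lemma eps_le_frac_iff:
  assumes "\<nu> f \<noteq> Infty" "0 < k"
  shows "eps \<nu> f \<le> Fin (divhull_frac c k) \<longleftrightarrow>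
    poly_valuation.slope_le (\<lambda>f. nmult k (\<nu> f)) (Val c) f"
proof -
  interpret w: poly_valuation "\<lambda>f. nmult k (\<nu> f)" by (rule valuation_multiple) fact
  obtain a where "\<nu> f = Val a" using assms(1) by (cases "\<nu> f") auto
  then show ?thesis
    using assms(2) by (auto simp: eps_le_iff w.slope_le_def eps_quot_le_iff)
qed

lemma eps_less_frac_iff:
  assumes "\<nu> f \<noteq> Infty" "0 < k"
  shows "eps \<nu> f < Fin (divhull_frac c k) \<longleftrightarrow>
    poly_valuation.slope_less (\<lambda>f. nmult k (\<nu> f)) (Val c) f"
proof -
  interpret w: poly_valuation "\<lambda>f. nmult k (\<nu> f)" by (rule valuation_multiple) fact
  obtain a where "\<nu> f = Val a" using assms(1) by (cases "\<nu> f") auto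
  then show ?thesis
    using assms(2) by (auto simp: eps_less_iff w.slope_less_def eps_quot_less_iff)
qed

text \<open>The Hasse derivative of order \<open>degree f\<close> is a nonzero constant, so its value is finite.\<close>

lemma eps_of_infinite_value:
  assumes "\<nu> f = Infty" "f \<noteq> 0"
  shows "eps \<nu> f = Pinf"
proof -
  have fin: "\<nu> [:lead_coeff f:] \<noteq> Infty" using assms by (intro val_const_finite) auto
  have "0 < degree f"
    using assms fin by (cases "degree f") (auto elim: degree_eq_zeroE)
  then have "eps_quot (\<nu> f) (\<nu> (hasse_deriv (degree f) f)) (degree f) \<le> eps \<nu> f"
    using eps_le_iff by blast
  then show ?thesis
    using fin assms(1) unfolding hasse_deriv_degree
    by (cases "\<nu> [:lead_coeff f:]"; cases "eps \<nu> f") auto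
qed

lemma eps_finite:
  assumes "\<nu> f \<noteq> Infty" "0 < degree f"
  obtains k c where "0 < k" "eps \<nu> f = Fin (divhull_frac c k)"
    "nmult k (\<nu> f) = nmult k (\<nu> (hasse_deriv k f)) + nmult k (Val c)"
proof -
  obtain a where a: "\<nu> f = Val a" using assms(1) by (cases "\<nu> f") auto
  obtain k where k: "0 < k" "eps \<nu> f = eps_quot (\<nu> f) (\<nu> (hasse_deriv k f)) k"
    by (rule eps_attained)
  have "\<nu> [:lead_coeff f:] \<noteq> Infty" using assms by (intro val_const_finite) auto
  then have "eps_quot (\<nu> f) (\<nu> (hasse_deriv (degree f) f)) (degree f) \<noteq> Minf"
    unfolding hasse_deriv_degree a by (cases "\<nu> [:lead_coeff f:]") auto
  moreover have "eps_quot (\<nu> f) (\<nu> (hasse_deriv (degree f) f)) (degree f) \<le> eps \<nu> f"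
    using eps_le_iff assms(2) by blast
  ultimately have "eps \<nu> f \<noteq> Minf" by (auto simp: less_eq_extended.simps)
  then obtain b where b: "\<nu> (hasse_deriv k f) = Val b"
    using k by (cases "\<nu> (hasse_deriv k f)") auto
  show ?thesis
    using k by (intro that[of k "a - b"]) (auto simp: a b nmult_Val nmult_diff)
qed


end


section \<open>Key polynomials\<close>

lemma degree_diff_monic:
  fixes f P :: "'a::field poly"
  assumes "lead_coeff f = 1" "lead_coeff P = 1" "degree f = degree P" "0 < degree P"
  shows "degree (f - P) < degree P"
  using assms
  by (cases "f = P") (auto intro!: degree_less_if_less_eqI degree_diff_le)

lemma degree_mod_less_pos:
  fixes f P :: "'a::field poly"
  assumes "0 < degree P"
  shows "degree (f mod P) < degree P"
  using degree_mod_less[of P f] assms by (metis degree_0 less_numeral_extra(3))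

lemma degree_div_less_degree:
  fixes f P :: "'a::field poly"
  assumes "0 < degree P" "degree f < degree P + degree P"
  shows "degree (f div P) < degree P"
proof (cases "f div P = 0")
  case False
  have "degree (f div P) + degree P = degree (f - f mod P)"
    using False assms(1) degree_mult_eq[of "f div P" P] by (cases "P = 0") (auto simp: minus_mod_eq_div_mult)
  also have "\<dots> < degree P + degree P"
    using assms degree_mod_less_pos[OF assms(1), of f] by (intro degree_diff_less) auto
  finally show ?thesis by simp
qed (use assms in auto)

context poly_valuation
begin

lemma key_poly_eps_less:
  assumes "key_poly \<nu> P" "degree f < degree P"
  shows "eps \<nu> f < eps \<nu> P"
  using assms unfolding key_poly_def by (meson not_le)

lemma key_poly_low_degree_finite:
  assumes "key_poly \<nu> P" "degree f < degree P" "f \<noteq> 0"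
  shows "\<nu> f \<noteq> Infty"
  using key_poly_eps_less[OF assms(1,2)] eps_of_infinite_value[of f] assms(3)
  by (cases "eps \<nu> P") auto

text \<open>A common denominator \<open>k\<close> under which all comparisons with \<open>\<epsilon> P\<close> become inequalities for
  \<open>k \<cdot> \<nu>\<close>. The order at which \<open>\<epsilon> P\<close> is attained serves as this denominator.\<close>

lemma key_poly_slope:
  assumes "key_poly \<nu> P" "\<nu> P \<noteq> Infty"
  obtains k c where "0 < k" "eps \<nu> P = Fin (divhull_frac c k)"
    "poly_valuation.slope_le (\<lambda>f. nmult k (\<nu> f)) (Val c) P"
    "nmult k (\<nu> P) = nmult k (\<nu> (hasse_deriv k P)) + nmult k (Val c)"
    "\<And>f. degree f < degree P \<Longrightarrow> f \<noteq> 0 \<Longrightarrow>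
      poly_valuation.slope_less (\<lambda>f. nmult k (\<nu> f)) (Val c) f"
proof -
  have "0 < degree P" using assms by (simp add: key_poly_def)
  then obtain k c where k: "0 < k" "eps \<nu> P = Fin (divhull_frac c k)"
    "nmult k (\<nu> P) = nmult k (\<nu> (hasse_deriv k P)) + nmult k (Val c)"
    by (rule eps_finite[OF assms(2)])
  show ?thesis
  proof (rule that[of k c])
    show "poly_valuation.slope_le (\<lambda>f. nmult k (\<nu> f)) (Val c) P"
      using eps_le_frac_iff[of P k c] assms(2) k by simp
    show "poly_valuation.slope_less (\<lambda>f. nmult k (\<nu> f)) (Val c) f"
      if "degree f < degree P" "f \<noteq> 0" for f
      using eps_less_frac_iff[of f k c] key_poly_eps_less[OF assms(1) that(1)]
        key_poly_low_degree_finite[OF assms(1) that] k by simp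
  qed (use k in auto)
qed

text \<open>Suppose that \<open>l * P\<close>, where \<open>l\<close> is the quotient, had a value not exceeding that of \<open>f * g\<close>,
  hence not exceeding that of the remainder. Multiplication by \<open>l\<close> does not change that \<open>\<epsilon> P\<close> is
  attained, so the derivative of \<open>l * P\<close> of the corresponding order has a smaller value than those
  of \<open>f * g\<close> and of the remainder, on which \<open>\<epsilon>\<close> is less than \<open>\<epsilon> P\<close>. But it is their difference.\<close>

theorem key_poly_division:
  assumes key: "key_poly \<nu> P" and P: "\<nu> P \<noteq> Infty"
    and f: "degree f < degree P" "f \<noteq> 0" and g: "degree g < degree P" "g \<noteq> 0"
  shows "\<nu> (f * g) < \<nu> ((f * g) div P * P)"
proof (rule ccontr)
  define l r where "l = (f * g) div P" and "r = (f * g) mod P"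
  have fg: "l * P = f * g - r" by (simp add: l_def r_def minus_mod_eq_div_mult)
  have fin: "\<nu> (f * g) \<noteq> Infty"
    using key_poly_low_degree_finite[OF key] f g by (simp add: val_mult)
  assume "\<not> \<nu> (f * g) < \<nu> ((f * g) div P * P)"
  then have le: "\<nu> (l * P) \<le> \<nu> (f * g)" by (simp add: l_def)
  then have lP: "\<nu> (l * P) \<noteq> Infty" using fin by auto
  then have "l \<noteq> 0" by auto
  have "0 < degree P" using f by simp
  have "degree (f * g) < degree P + degree P" using f g by (simp add: degree_mult_eq)
  then have "degree l < degree P"
    unfolding l_def by (rule degree_div_less_degree[OF \<open>0 < degree P\<close>])
  have r_low: "degree r < degree P"
    unfolding r_def by (rule degree_mod_less_pos) fact
  obtain k c where k: "0 < k"
    "poly_valuation.slope_le (\<lambda>f. nmult k (\<nu> f)) (Val c) P"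
    "nmult k (\<nu> P) = nmult k (\<nu> (hasse_deriv k P)) + nmult k (Val c)"
    and low: "\<And>f. degree f < degree P \<Longrightarrow> f \<noteq> 0 \<Longrightarrow>
      poly_valuation.slope_less (\<lambda>f. nmult k (\<nu> f)) (Val c) f"
    using key_poly_slope[OF key P] by metis
  interpret w: poly_valuation "\<lambda>f. nmult k (\<nu> f)" by (rule valuation_multiple) fact
  let ?w = "\<lambda>f. nmult k (\<nu> f)"
  have wfin: "?w h \<noteq> Infty" if "\<nu> h \<noteq> Infty" for h
    using that by (simp add: nmult_eq_Infty_iff)
  have att: "?w (hasse_deriv k (l * P)) + nmult k (Val c) = ?w (l * P)"
    by (rule w.slope_attained_mult)
      (use k low \<open>degree l < degree P\<close> \<open>l \<noteq> 0\<close> key_poly_low_degree_finite[OF key] P wfin in auto)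
  have "w.slope_less (Val c) (f * g)"
    by (rule w.slope_less_mult) (use low f g key_poly_low_degree_finite[OF key] wfin in auto)
  then have "?w (f * g) < ?w (hasse_deriv k (f * g)) + nmult k (Val c)"
    using k(1) by (auto simp: w.slope_less_def)
  moreover have lefg: "?w (l * P) \<le> ?w (f * g)" using le by (rule nmult_mono)
  ultimately have 1: "?w (l * P) < ?w (hasse_deriv k (f * g)) + nmult k (Val c)" by simp
  have 2: "?w (l * P) < ?w (hasse_deriv k r) + nmult k (Val c)"
  proof (cases "r = 0")
    case True
    then show ?thesis using wfin[OF lP] k(1) by (simp add: nmult_Infty)
  next
    case False
    have "r = f * g - l * P" using fg by simp
    then have "?w (l * P) \<le> ?w r" using lefg by (auto intro: w.val_ge_diff)
    also have "\<dots> < ?w (hasse_deriv k r) + nmult k (Val c)"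
      using low[OF r_low False] k(1) by (auto simp: w.slope_less_def)
    finally show ?thesis .
  qed
  have "?w (l * P) < ?w (hasse_deriv k (l * P)) + nmult k (Val c)"
    unfolding fg hasse_deriv_diff by (rule w.val_gt_diff_shift) (use 1 2 fg in simp_all)
  with att show False by simp
qed

text \<open>The difference \<open>f - P\<close> has the value of \<open>P\<close> but, having smaller degree, a smaller \<open>\<epsilon>\<close>. So it does
  not affect the value of the derivative at which \<open>\<epsilon> P\<close> is attained: there \<open>f\<close> and \<open>P\<close> have
  derivatives of equal value, while \<open>f\<close> itself has the larger value.\<close>

lemma key_poly_eps_increases:
  assumes key: "key_poly \<nu> P" and f: "lead_coeff f = 1" "degree f = degree P"
    and less: "\<nu> P < \<nu> f"
  shows "eps \<nu> P < eps \<nu> f"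
proof (cases "\<nu> f = Infty")
  case True
  then have "eps \<nu> f = Pinf" using f by (intro eps_of_infinite_value) auto
  moreover have "\<nu> P \<noteq> Infty" using less by auto
  ultimately show ?thesis
    using key by (auto simp: key_poly_def elim: eps_finite[of P])
next
  case False
  have P: "\<nu> P \<noteq> Infty" using less by auto
  have monic: "lead_coeff P = 1" "0 < degree P" using key by (auto simp: key_poly_def)
  define h where "h = f - P"
  have h: "\<nu> h = \<nu> P"
  proof -
    have "\<nu> (- P + f) = \<nu> (- P)" using less by (intro val_add_eq) simp
    then show ?thesis by (simp add: h_def)
  qed
  then have "h \<noteq> 0" using P by auto
  have "degree h < degree P" unfolding h_def using f monic by (intro degree_diff_monic)
  obtain k c where k: "0 < k" "eps \<nu> P = Fin (divhull_frac c k)"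
    "poly_valuation.slope_le (\<lambda>f. nmult k (\<nu> f)) (Val c) P"
    "nmult k (\<nu> P) = nmult k (\<nu> (hasse_deriv k P)) + nmult k (Val c)"
    and low: "poly_valuation.slope_less (\<lambda>f. nmult k (\<nu> f)) (Val c) h"
    using key_poly_slope[OF key P] \<open>h \<noteq> 0\<close> \<open>degree h < degree P\<close> by metis
  interpret w: poly_valuation "\<lambda>f. nmult k (\<nu> f)" by (rule valuation_multiple) fact
  let ?w = "\<lambda>f. nmult k (\<nu> f)"
  have "\<not> eps \<nu> f \<le> eps \<nu> P"
  proof
    assume "eps \<nu> f \<le> eps \<nu> P"
    then have "w.slope_le (Val c) f" using eps_le_frac_iff[OF False k(1)] k(2) by simp
    then have "?w f \<le> ?w (hasse_deriv k f) + nmult k (Val c)" by (rule w.slope_le_all)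
    moreover have "?w P < ?w f" using less k(1) by (simp add: nmult_less_iff)
    ultimately have 1: "?w P < ?w (hasse_deriv k f) + nmult k (Val c)" by simp
    have "?w h < ?w (hasse_deriv k h) + nmult k (Val c)"
      using low k(1) by (simp add: w.slope_less_def)
    then have 2: "?w P < ?w (hasse_deriv k h) + nmult k (Val c)" by (simp add: h)
    have "P = f - h" by (simp add: h_def)
    then have "?w P < ?w (hasse_deriv k P) + nmult k (Val c)"
      using w.val_gt_diff_shift[OF 1 2] by (simp add: hasse_deriv_diff)
    with k(4) show False by simp
  qed
  then show ?thesis by simp
qed

text \<open>Again \<open>f - P\<close> has a smaller \<open>\<epsilon>\<close> than \<open>P\<close>, and its value is at least the common value of \<open>f\<close>
  and \<open>P\<close>; thus each derivative of \<open>f\<close> inherits the lower bound that holds for \<open>P\<close>.\<close>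

lemma key_poly_eps_tie:
  assumes key: "key_poly \<nu> P" and f: "lead_coeff f = 1" "degree f = degree P"
    and eq: "\<nu> f = \<nu> P" and P: "\<nu> P \<noteq> Infty"
  shows "eps \<nu> f \<le> eps \<nu> P"
proof (cases "f = P")
  case False
  have monic: "lead_coeff P = 1" "0 < degree P" using key by (auto simp: key_poly_def)
  define h where "h = f - P"
  have fin: "\<nu> f \<noteq> Infty" using eq P by simp
  have h: "\<nu> P \<le> \<nu> h" unfolding h_def by (rule val_ge_diff) (simp_all add: eq)
  have "h \<noteq> 0" using False by (simp add: h_def)
  have "degree h < degree P" unfolding h_def using f monic by (intro degree_diff_monic)
  obtain k c where k: "0 < k" "eps \<nu> P = Fin (divhull_frac c k)"
    "poly_valuation.slope_le (\<lambda>f. nmult k (\<nu> f)) (Val c) P"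
    and low: "poly_valuation.slope_less (\<lambda>f. nmult k (\<nu> f)) (Val c) h"
    using key_poly_slope[OF key P] \<open>h \<noteq> 0\<close> \<open>degree h < degree P\<close> by metis
  interpret w: poly_valuation "\<lambda>f. nmult k (\<nu> f)" by (rule valuation_multiple) fact
  let ?w = "\<lambda>f. nmult k (\<nu> f)"
  have "w.slope_le (Val c) f"
    unfolding w.slope_le_def
  proof (intro allI impI)
    fix i :: nat
    have 1: "?w P \<le> ?w (hasse_deriv i P) + nmult i (Val c)"
      using k(3) by (rule w.slope_le_all)
    have "?w P \<le> ?w h" using h by (rule nmult_mono)
    also have "\<dots> \<le> ?w (hasse_deriv i h) + nmult i (Val c)"
      using low by (intro w.slope_le_all w.slope_less_imp_le)
    finally have 2: "?w P \<le> ?w (hasse_deriv i h) + nmult i (Val c)" .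
    have "f = P + h" by (simp add: h_def)
    then show "?w f \<le> ?w (hasse_deriv i f) + nmult i (Val c)"
      using w.val_ge_add_shift[OF 1 2] by (simp add: hasse_deriv_add eq[symmetric])
  qed
  then show ?thesis using eps_le_frac_iff[OF fin k(1)] k(2) by simp
qed simp

end


section \<open>Truncations\<close>

lemma expansion_eval: "0 < degree q \<Longrightarrow> poly (expansion q f) q = f"
  and degree_coeff_expansion: "0 < degree q \<Longrightarrow> degree (coeff (expansion q f) i) < degree q"
  using theI'[OF expansion_exists_unique[of q f]] unfolding expansion_def by auto

lemma expansion_unique:
  assumes "0 < degree q" "poly F q = f" "\<And>i. degree (coeff F i) < degree q"
  shows "expansion q f = F"
  using expansion_exists_unique[OF assms(1), of f] expansion_eval[OF assms(1), of f]
    degree_coeff_expansion[OF assms(1), of f] assms(2,3) by blast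

lemma expansion_add:
  assumes "0 < degree q"
  shows "expansion q (f + g) = expansion q f + expansion q g"
  using assms
  by (intro expansion_unique) (auto simp: expansion_eval degree_coeff_expansion degree_add_less)

lemma expansion_linear:
  assumes "0 < degree q" "degree a < degree q" "degree b < degree q"
  shows "expansion q (a + b * q) = [:a, b:]"
  using assms
  by (intro expansion_unique) (auto simp: coeff_pCons mult.commute split: nat.splits)

lemma expansion_sum:
  assumes "0 < degree q"
  shows "f = (\<Sum>i\<le>degree (expansion q f). coeff (expansion q f) i * q ^ i)"
  using expansion_eval[OF assms, of f] by (simp add: poly_altdef)

text \<open>A product of coefficients of two expansions has degree less than \<open>2 * degree P\<close>, so one
  division with remainder by \<open>P\<close> suffices to bring it back below \<open>degree P\<close>; only one carry
  arises.\<close>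

lemma coeff_expansion_mult:
  fixes P f g :: "'k::field poly"
  assumes P: "0 < degree P"
  defines "F \<equiv> expansion P f" and "G \<equiv> expansion P g"
  shows "coeff (expansion P (f * g)) m =
    (\<Sum>i\<le>m. coeff F i * coeff G (m - i) mod P) +
    (case m of 0 \<Rightarrow> 0 | Suc n \<Rightarrow> \<Sum>i\<le>n. coeff F i * coeff G (n - i) div P)"
proof -
  define R where "R = map_poly (\<lambda>c. c mod P) (F * G)"
  define L where "L = map_poly (\<lambda>c. c div P) (F * G)"
  have "F * G = R + smult P L"
    by (rule poly_eqI) (simp add: R_def L_def coeff_map_poly mod_mult_div_eq del: coeff_mult)
  then have "poly (R + pCons 0 L) P = poly (F * G) P" by simp
  then have eval: "poly (R + pCons 0 L) P = f * g"
    using P by (simp add: F_def G_def expansion_eval)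
  have low: "degree (coeff (F * G) i) < degree P + degree P" for i
  proof -
    have "degree (coeff F j * coeff G (i - j)) < degree P + degree P" for j
      using degree_mult_le[of "coeff F j" "coeff G (i - j)"]
        degree_coeff_expansion[OF P, of f j] degree_coeff_expansion[OF P, of g "i - j"]
      by (simp add: F_def G_def)
    then show ?thesis unfolding coeff_mult
      using P by (intro degree_sum_less) auto
  qed
  have "degree (coeff (R + pCons 0 L) i) < degree P" for i
    using P degree_mod_less_pos[OF P] degree_div_less_degree[OF P low]
    by (auto simp: R_def L_def coeff_map_poly coeff_pCons degree_add_less
      simp del: coeff_mult split: nat.splits)
  then have "expansion P (f * g) = R + pCons 0 L"
    by (intro expansion_unique P eval)
  moreover have "sum h I mod P = (\<Sum>i\<in>I. h i mod P)" for h :: "nat \<Rightarrow> 'k poly" and I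
    by (induction I rule: infinite_finite_induct) (auto simp: poly_mod_add_left)
  moreover have "sum h I div P = (\<Sum>i\<in>I. h i div P)" for h :: "nat \<Rightarrow> 'k poly" and I
    by (induction I rule: infinite_finite_induct) (auto simp: poly_div_add_left)
  ultimately show ?thesis
    by (auto simp: R_def L_def coeff_map_poly coeff_pCons coeff_mult split: nat.splits)
qed

context poly_valuation
begin

lemma finite_truncation_terms: "finite (range (\<lambda>i. \<nu> (coeff (expansion P f) i * P ^ i)))"
proof (rule finite_subset)
  show "range (\<lambda>i. \<nu> (coeff (expansion P f) i * P ^ i)) \<subseteq>
      insert Infty ((\<lambda>i. \<nu> (coeff (expansion P f) i * P ^ i)) ` {..degree (expansion P f)})"
  proof (rule image_subsetI)
    fix i
    show "\<nu> (coeff (expansion P f) i * P ^ i) \<in>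
        insert Infty ((\<lambda>i. \<nu> (coeff (expansion P f) i * P ^ i)) ` {..degree (expansion P f)})"
      by (cases "degree (expansion P f) < i") (auto simp: coeff_eq_0)
  qed
qed simp

lemma le_truncation_iff:
  "v \<le> truncation \<nu> P f \<longleftrightarrow> (\<forall>i. v \<le> \<nu> (coeff (expansion P f) i * P ^ i))"
  unfolding truncation_def by (subst Min_ge_iff[OF finite_truncation_terms]) auto

lemma truncation_le_term: "truncation \<nu> P f \<le> \<nu> (coeff (expansion P f) i * P ^ i)"
  using le_truncation_iff by blast

lemma truncation_attained:
  obtains i where "truncation \<nu> P f = \<nu> (coeff (expansion P f) i * P ^ i)"
  using Min_in[OF finite_truncation_terms[of P f]] unfolding truncation_def by auto

lemma truncation_le:
  assumes "0 < degree P"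
  shows "truncation \<nu> P f \<le> \<nu> f"
  by (subst (2) expansion_sum[OF assms, of f]) (intro val_sum_ge truncation_le_term)

lemma truncation_linear:
  assumes "0 < degree P" "degree a < degree P" "degree b < degree P"
  shows "truncation \<nu> P (a + b * P) = min (\<nu> a) (\<nu> (b * P))"
proof -
  have "v \<le> truncation \<nu> P (a + b * P) \<longleftrightarrow> v \<le> min (\<nu> a) (\<nu> (b * P))" for v
    unfolding le_truncation_iff expansion_linear[OF assms]
    by (auto simp: coeff_pCons split: nat.splits elim: allE[of _ 0] allE[of _ 1])
  then show ?thesis by (meson order.antisym order.refl)
qed

lemma truncation_low_degree:
  assumes "degree a < degree P"
  shows "truncation \<nu> P a = \<nu> a"
  using truncation_linear[of P a 0] assms by simp

lemma truncation_add_ge: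
  assumes "0 < degree P"
  shows "min (truncation \<nu> P f) (truncation \<nu> P g) \<le> truncation \<nu> P (f + g)"
  unfolding le_truncation_iff expansion_add[OF assms] coeff_add ring_distribs
  by (intro allI val_ge_add) (auto intro: min.coboundedI1 min.coboundedI2 truncation_le_term)

end

text \<open>The last axiom says that the residue modulo \<open>P\<close> of a product of two polynomials of degree
  less than \<open>degree P\<close> carries the value of the product. The axioms isolate what makes the
  truncation at a key polynomial of finite value a valuation; \<open>\<epsilon>\<close> does not occur in them.\<close>

locale truncation_centre = poly_valuation +
  fixes P :: "'a poly"
  assumes monic: "lead_coeff P = 1"
    and degree_pos: "0 < degree P"
    and value_finite: "\<nu> P \<noteq> Infty"
    and low_finite: "degree f < degree P \<Longrightarrow> f \<noteq> 0 \<Longrightarrow> \<nu> f \<noteq> Infty"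
    and div_value_gt: "degree f < degree P \<Longrightarrow> f \<noteq> 0 \<Longrightarrow> degree g < degree P \<Longrightarrow> g \<noteq> 0 \<Longrightarrow>
      \<nu> (f * g) < \<nu> ((f * g) div P * P)"

lemma (in poly_valuation) key_poly_truncation_centre:
  assumes "key_poly \<nu> P" "\<nu> P \<noteq> Infty"
  shows "truncation_centre \<nu> P"
proof
  show "lead_coeff P = 1" "0 < degree P" using assms by (auto simp: key_poly_def)
qed (use assms key_poly_low_degree_finite key_poly_division in blast)+

context truncation_centre
begin

lemma mod_value:
  assumes "degree f < degree P" "degree g < degree P"
  shows "\<nu> (f * g mod P) = \<nu> (f * g)"
proof (cases "f = 0 \<or> g = 0")
  case False
  then have "\<nu> (f * g) < \<nu> (- (f * g div P * P))"
    using div_value_gt[of f g] assms by simp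
  from val_add_eq[OF this] show ?thesis by (simp add: minus_div_mult_eq_mod)
qed auto

lemma power_finite: "\<nu> (P ^ k) \<noteq> Infty"
  using value_finite by (simp add: val_power nmult_eq_Infty_iff)

lemma mod_term:
  assumes "degree a < degree P" "degree b < degree P"
  shows "\<nu> ((a * b mod P) * P ^ (i + j)) = \<nu> (a * P ^ i) + \<nu> (b * P ^ j)"
  using mod_value[OF assms] by (simp add: val_mult power_add ac_simps)

lemma div_term:
  assumes "degree a < degree P" "degree b < degree P"
    and "\<gamma> \<noteq> Infty" "\<gamma> \<le> \<nu> (a * P ^ i) + \<nu> (b * P ^ j)"
  shows "\<gamma> < \<nu> ((a * b div P) * P ^ Suc (i + j))"
proof (cases "a = 0 \<or> b = 0")
  case False
  have "\<gamma> \<le> \<nu> (P ^ (i + j)) + \<nu> (a * b)"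
    using assms(4) by (simp add: val_mult power_add ac_simps)
  also have "\<dots> < \<nu> (P ^ (i + j)) + \<nu> (a * b div P * P)"
    using False assms div_value_gt[of a b] power_finite[of "i + j"] by simp
  also have "\<dots> = \<nu> ((a * b div P) * P ^ Suc (i + j))"
    by (simp add: val_mult ac_simps)
  finally show ?thesis .
qed (use assms in auto)

lemma truncation_not_Infty:
  assumes "f \<noteq> 0"
  shows "truncation \<nu> P f \<noteq> Infty"
proof -
  have "expansion P f \<noteq> 0" using assms expansion_eval[OF degree_pos, of f] by auto
  then obtain i where "coeff (expansion P f) i \<noteq> 0" by (auto simp: poly_eq_iff)
  then have "\<nu> (coeff (expansion P f) i * P ^ i) \<noteq> Infty"
    using low_finite[OF degree_coeff_expansion[OF degree_pos]] power_finite by (simp add: val_mult)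
  then show ?thesis using truncation_le_term[of P f i] by auto
qed

text \<open>The first coefficient at which the minimum is reached, for \<open>f\<close> and for \<open>g\<close>, contributes to
  the expansion of \<open>f * g\<close> a term whose value is the sum of the two minima, and no other
  contribution to that coefficient has so small a value: the carries have larger values, and in
  any other product one factor precedes the first minimal term.\<close>

theorem truncation_mult: "truncation \<nu> P (f * g) = truncation \<nu> P f + truncation \<nu> P g"
proof (cases "f = 0 \<or> g = 0")
  case True
  have "truncation \<nu> P 0 = Infty" using degree_pos by (simp add: truncation_low_degree)
  with True show ?thesis by auto
next
  case False
  define F G where "F = expansion P f" and "G = expansion P g"
  define s t where "s = truncation \<nu> P f" and "t = truncation \<nu> P g"
  have low: "degree (coeff F i) < degree P" "degree (coeff G i) < degree P" for i
    by (simp_all add: F_def G_def degree_coeff_expansion degree_pos)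
  have fin: "s \<noteq> Infty" "t \<noteq> Infty"
    using False by (auto simp: s_def t_def truncation_not_Infty)
  have ge: "s \<le> \<nu> (coeff F i * P ^ i)" "t \<le> \<nu> (coeff G i * P ^ i)" for i
    by (simp_all add: s_def t_def F_def G_def truncation_le_term)
  \<comment> \<open>The remainders and the carries in the coefficient of index \<open>m\<close>.\<close>
  define M where "M m = (\<Sum>i\<le>m. (coeff F i * coeff G (m - i) mod P) * P ^ m)" for m
  define D where "D m = (case m of 0 \<Rightarrow> 0
    | Suc n \<Rightarrow> \<Sum>i\<le>n. (coeff F i * coeff G (n - i) div P) * P ^ m)" for m
  have coeff: "coeff (expansion P (f * g)) m * P ^ m = M m + D m" for m
    unfolding coeff_expansion_mult[OF degree_pos] F_def[symmetric] G_def[symmetric] M_def D_def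
    by (cases m) (simp_all add: ring_distribs sum_distrib_right del: power_Suc)
  have D: "s + t < \<nu> (D m)" for m
  proof (cases m)
    case (Suc n)
    have "s + t < \<nu> ((coeff F i * coeff G (n - i) div P) * P ^ Suc n)" if "i \<le> n" for i
      using div_term[OF low, of "s + t" i i "n - i" "n - i"] that fin ge
      by (simp add: add_mono del: power_Suc)
    then show ?thesis
      unfolding D_def Suc nat.case using fin by (intro val_sum_gt) auto
  qed (use fin in \<open>simp add: D_def\<close>)
  have Mterm: "\<nu> ((coeff F i * coeff G (m - i) mod P) * P ^ m) =
      \<nu> (coeff F i * P ^ i) + \<nu> (coeff G (m - i) * P ^ (m - i))" if "i \<le> m" for i m
    using mod_term[OF low, of i "m - i" i "m - i"] that by simp
  have M: "s + t \<le> \<nu> (M m)" for m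
    unfolding M_def by (rule val_sum_ge) (simp add: Mterm ge add_mono)
  have "s + t \<le> truncation \<nu> P (f * g)"
    unfolding le_truncation_iff coeff using M D by (auto intro: val_ge_add less_imp_le)
  moreover have "truncation \<nu> P (f * g) \<le> s + t"
  proof -
    have "\<exists>i. \<nu> (coeff F i * P ^ i) = s" "\<exists>i. \<nu> (coeff G i * P ^ i) = t"
      unfolding s_def t_def F_def G_def by (metis truncation_attained)+
    then obtain a b where a: "\<nu> (coeff F a * P ^ a) = s"
      "\<And>i. i < a \<Longrightarrow> \<nu> (coeff F i * P ^ i) \<noteq> s"
      and b: "\<nu> (coeff G b * P ^ b) = t" "\<And>i. i < b \<Longrightarrow> \<nu> (coeff G i * P ^ i) \<noteq> t"
      unfolding exists_least_iff[of "\<lambda>i. _ i = _"] by blast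
    \<comment> \<open>The remainders that make up \<open>M (a + b)\<close>; the one of index \<open>a\<close> dominates.\<close>
    define h where "h i = (coeff F i * coeff G (a + b - i) mod P) * P ^ (a + b)" for i
    have "M (a + b) = h a + sum h ({..a + b} - {a})"
      unfolding M_def h_def by (rule sum.remove) auto
    moreover have ha: "\<nu> (h a) = s + t" using Mterm[of a "a + b"] by (simp add: h_def a b)
    moreover have "s + t < \<nu> (sum h ({..a + b} - {a}))"
    proof (rule val_sum_gt)
      show "s + t \<noteq> Infty" using fin by simp
    next
      fix i assume i: "i \<in> {..a + b} - {a}"
      then consider "i < a" | "a + b - i < b" by force
      then have "s < \<nu> (coeff F i * P ^ i) \<or> t < \<nu> (coeff G (a + b - i) * P ^ (a + b - i))"
        using a(2) b(2) ge by cases (blast intro: order.not_eq_order_implies_strict)+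
      then have "s + t < \<nu> (coeff F i * P ^ i) + \<nu> (coeff G (a + b - i) * P ^ (a + b - i))"
        using ge fin by (auto intro: vext_add_less_le_mono vext_add_le_less_mono)
      then show "s + t < \<nu> (h i)" using Mterm[of i "a + b"] i by (simp add: h_def)
    qed
    ultimately have "\<nu> (M (a + b)) = s + t" by (simp add: val_add_eq)
    then have "\<nu> (M (a + b) + D (a + b)) = s + t" using D[of "a + b"] by (simp add: val_add_eq)
    then show ?thesis using truncation_le_term[of P "f * g" "a + b"] by (simp add: coeff)
  qed
  ultimately show ?thesis by (simp add: s_def t_def)
qed

theorem truncation_valuation: "poly_valuation (truncation \<nu> P)"
  using degree_pos
  by unfold_locales
    (simp add: valuation_def truncation_mult truncation_add_ge truncation_low_degree)

end


lemma truncation_of_monic: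
  assumes "poly_valuation \<nu>" "lead_coeff P = 1" "0 < degree P" "lead_coeff f = 1" "degree f = degree P"
  shows "truncation \<nu> P f = min (\<nu> (f - P)) (\<nu> P)"
  using poly_valuation.truncation_linear[OF assms(1), of P "f - P" 1] assms
    degree_diff_monic[of f P]
  by simp

text \<open>The truncation at \<open>P'\<close> is itself a valuation, agrees with \<open>\<nu>\<close> below \<open>degree P\<close>, and gives \<open>P\<close> a
  value of at least \<open>\<nu> P\<close>; so it is at least the minimum of the values of the terms in the
  \<open>P\<close>-expansion of \<open>f\<close>.\<close>

theorem truncation_mono:
  assumes "truncation_centre \<nu> P" "truncation_centre \<nu> P'"
    and deg: "degree P = degree P'" and le: "\<nu> P \<le> \<nu> P'"
  shows "truncation \<nu> P f \<le> truncation \<nu> P' f"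
proof -
  interpret P: truncation_centre \<nu> P by fact
  interpret P': truncation_centre \<nu> P' by fact
  interpret t': poly_valuation "truncation \<nu> P'" by (rule P'.truncation_valuation)
  have P: "\<nu> P \<le> truncation \<nu> P' P"
    using deg le P.monic P'.monic P'.degree_pos
    by (simp add: truncation_of_monic[OF P.poly_valuation_axioms] P.val_ge_diff)
  have "truncation \<nu> P f \<le> truncation \<nu> P' (coeff (expansion P f) i * P ^ i)" for i
  proof -
    have "truncation \<nu> P f \<le> \<nu> (coeff (expansion P f) i) + nmult i (\<nu> P)"
      using P.truncation_le_term[of P f i] by (simp add: P.val_mult P.val_power)
    also have "\<dots> \<le> \<nu> (coeff (expansion P f) i) + nmult i (truncation \<nu> P' P)"
      by (intro add_left_mono nmult_mono P)
    also have "\<dots> = truncation \<nu> P' (coeff (expansion P f) i * P ^ i)"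
      using degree_coeff_expansion[OF P.degree_pos, of f i] deg
      by (simp add: t'.val_mult t'.val_power P.truncation_low_degree)
    finally show ?thesis .
  qed
  then show ?thesis
    by (subst (2) expansion_sum[OF P.degree_pos, of f]) (intro t'.val_sum_ge)
qed


section \<open>MacLane--Vaquie key polynomials from an increase of values\<close>

context poly_valuation
begin

lemma val_equivD:
  assumes "val_equiv \<nu> f g" "\<nu> f \<noteq> Infty"
  shows "\<nu> g = \<nu> f" "\<nu> f < \<nu> (f - g)"
proof -
  obtain \<gamma> where \<gamma>: "\<nu> f = Val \<gamma>" using assms(2) by (cases "\<nu> f") auto
  have "0 \<in> val_gt \<nu> \<gamma>" by (simp add: val_gt_def)
  then have "f \<in> init_form \<nu> f \<gamma>" using \<gamma> by (force simp: init_form_def)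
  then have f: "f \<in> init_form \<nu> g \<gamma>" using assms(1) by (simp add: val_equiv_def)
  show g: "\<nu> g = \<nu> f"
  proof (rule ccontr)
    assume "\<nu> g \<noteq> \<nu> f"
    then show False using f \<gamma> by (simp add: init_form_def val_gt_def)
  qed
  then obtain b where "f = g + b" "b \<in> val_gt \<nu> \<gamma>" using f \<gamma> by (auto simp: init_form_def)
  then show "\<nu> f < \<nu> (f - g)" using \<gamma> by (simp add: val_gt_def)
qed

lemma val_equivI:
  assumes "\<nu> f < \<nu> (f - g)"
  shows "val_equiv \<nu> f g"
proof -
  have g: "\<nu> g = \<nu> f"
  proof -
    have "\<nu> (f + - (f - g)) = \<nu> f" using assms by (intro val_add_eq) (simp only: val_minus)
    then show ?thesis by simp
  qed
  have "{f + b |b. b \<in> val_gt \<nu> \<gamma>} = {g + b |b. b \<in> val_gt \<nu> \<gamma>}" if "\<nu> f = Val \<gamma>" for \<gamma>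
  proof (intro equalityI subsetI; elim CollectE exE conjE)
    fix x b assume x: "x = f + b" "b \<in> val_gt \<nu> \<gamma>"
    then have "x = g + ((f - g) + b)" by simp
    moreover have "(f - g) + b \<in> val_gt \<nu> \<gamma>"
      using x assms that by (simp add: val_gt_def val_gt_add)
    ultimately show "x \<in> {g + b |b. b \<in> val_gt \<nu> \<gamma>}" by blast
  next
    fix x b assume x: "x = g + b" "b \<in> val_gt \<nu> \<gamma>"
    then have "x = f + (b - (f - g))" by simp
    moreover have "b - (f - g) \<in> val_gt \<nu> \<gamma>"
      using x assms that by (simp add: val_gt_def val_gt_diff)
    ultimately show "x \<in> {f + b |b. b \<in> val_gt \<nu> \<gamma>}" by blast
  qed
  then show ?thesis unfolding val_equiv_def by (intro ext) (auto simp: init_form_def g)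
qed

lemma val_dvd_of_large_remainder:
  assumes "\<nu> f < \<nu> (f mod P)"
  shows "val_dvd \<nu> P f"
  unfolding val_dvd_def
  by (rule exI[of _ "f div P"], rule val_equivI)
    (use assms in \<open>simp add: minus_mult_div_eq_mod\<close>)

lemma val_dvd_zero: "val_dvd \<nu> P 0"
  unfolding val_dvd_def val_equiv_def by (rule exI[of _ 0]) simp

text \<open>If \<open>f\<close> is equivalent to \<open>P * h\<close>, then \<open>\<nu>'\<close> exceeds \<open>\<nu> f\<close> both on \<open>P * h\<close>, because of the
  factor \<open>P\<close>, and on \<open>f - P * h\<close>, where \<open>\<nu>\<close> does so already.\<close>

lemma val_dvd_imp_value_increase:
  assumes \<nu>': "poly_valuation \<nu>'" and le: "\<And>h. \<nu> h \<le> \<nu>' h" and P: "\<nu> P < \<nu>' P"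
    and dvd: "val_dvd \<nu> P f" and f: "\<nu> f \<noteq> Infty"
  shows "\<nu> f < \<nu>' f"
proof -
  interpret \<nu>': poly_valuation \<nu>' by fact
  obtain h where "val_equiv \<nu> f (P * h)" using dvd by (auto simp: val_dvd_def)
  then have h: "\<nu> (P * h) = \<nu> f" "\<nu> f < \<nu> (f - P * h)" using f by (auto dest: val_equivD)
  then have "\<nu> h \<noteq> Infty" using f by (auto simp: val_mult)
  then have "\<nu> f < \<nu>' (P * h)"
    unfolding h(1)[symmetric] val_mult \<nu>'.val_mult by (intro vext_add_less_le_mono P le)
  moreover have "\<nu> f < \<nu>' (f - P * h)" using h(2) le by (rule order.strict_trans2)
  ultimately show ?thesis using \<nu>'.val_gt_add[of "\<nu> f" "P * h" "f - P * h"] by simp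
qed

end

text \<open>The last assumption makes the converse of the preceding lemma true. It holds when \<open>\<nu>'\<close> is the
  truncation at \<open>P\<close>, since \<open>f mod P\<close> is the constant term of the \<open>P\<close>-expansion of \<open>f\<close>.\<close>

locale value_increase = poly_valuation +
  fixes \<nu>' :: "'a poly \<Rightarrow> 'b vext" and P :: "'a poly"
  assumes valuation': "poly_valuation \<nu>'"
    and monic: "lead_coeff P = 1" and degree_pos: "0 < degree P"
    and trivial_support: "f \<noteq> 0 \<Longrightarrow> \<nu> f \<noteq> Infty"
    and increase: "\<nu> f \<le> \<nu>' f"
    and low_degree: "degree f < degree P \<Longrightarrow> \<nu>' f = \<nu> f"
    and strict: "\<nu> P < \<nu>' P"
    and remainder: "\<nu>' f \<le> \<nu>' (f mod P)"
begin

theorem val_dvd_iff: "f \<noteq> 0 \<Longrightarrow> val_dvd \<nu> P f \<longleftrightarrow> \<nu> f < \<nu>' f"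
proof
  assume "\<nu> f < \<nu>' f"
  also have "\<dots> \<le> \<nu> (f mod P)"
    using remainder[of f] low_degree[OF degree_mod_less_pos[OF degree_pos, of f]] by simp
  finally show "val_dvd \<nu> P f" by (rule val_dvd_of_large_remainder)
qed (auto intro: val_dvd_imp_value_increase valuation' increase strict simp: trivial_support)

theorem is_MLV_key_poly: "MLV_key_poly \<nu> P"
proof -
  interpret \<nu>': poly_valuation \<nu>' by (rule valuation')
  have "val_dvd \<nu> P f \<or> val_dvd \<nu> P g" if "val_dvd \<nu> P (f * g)" for f g
  proof (cases "f = 0 \<or> g = 0")
    case False
    then have "\<nu> (f * g) < \<nu>' (f * g)" using that val_dvd_iff[of "f * g"] by simp
    then have "\<not> (\<nu> f = \<nu>' f \<and> \<nu> g = \<nu>' g)" by (auto simp: val_mult \<nu>'.val_mult)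
    then show ?thesis using False increase[of f] increase[of g] by (auto simp: val_dvd_iff)
  qed (auto simp: val_dvd_zero)
  moreover have "degree P \<le> degree f" if "f \<noteq> 0" "val_dvd \<nu> P f" for f
    using that low_degree[of f] by (auto simp: val_dvd_iff intro: leI)
  ultimately show ?thesis unfolding MLV_key_poly_def using monic by blast
qed

end

context
  fixes \<nu> :: "('k::field, 'g::linordered_ab_group_add) pval" and P P' :: "'k poly"
  assumes P: "truncation_centre \<nu> P" and P': "truncation_centre \<nu> P'"
    and degree: "degree P = degree P'" and less: "\<nu> P < \<nu> P'"
begin

interpretation P: truncation_centre \<nu> P by (rule P)
interpretation P': truncation_centre \<nu> P' by (rule P')

lemma value_of_difference: "\<nu> (P' - P) = \<nu> P"
  using P.val_add_eq[of "- P" P'] less by simp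

lemma truncation_of_better_centre: "truncation \<nu> P P' = \<nu> P"
  using truncation_of_monic[OF P.poly_valuation_axioms P.monic P.degree_pos P'.monic]
  by (simp add: degree value_of_difference)

lemma truncation_value_increase: "value_increase (truncation \<nu> P) (truncation \<nu> P') P'"
proof (intro value_increase.intro value_increase_axioms.intro)
  show "truncation \<nu> P f \<le> truncation \<nu> P' f" for f
    using less by (intro truncation_mono P P' degree) simp
  show "truncation \<nu> P' f = truncation \<nu> P f" if "degree f < degree P'" for f
    using that by (simp add: P.truncation_low_degree degree)
  show "truncation \<nu> P P' < truncation \<nu> P' P'"
    using less by (simp add: truncation_of_better_centre
        truncation_of_monic[OF P.poly_valuation_axioms P'.monic P'.degree_pos P'.monic])
  show "truncation \<nu> P' f \<le> truncation \<nu> P' (f mod P')" for f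
  proof -
    have "coeff (expansion P' f) 0 = f mod P'"
    proof -
      obtain a F where F: "expansion P' f = pCons a F" by (cases "expansion P' f")
      then have "a + P' * poly F P' = f" using expansion_eval[OF P'.degree_pos, of f] by simp
      moreover have "degree a < degree P'"
        using degree_coeff_expansion[OF P'.degree_pos, of f 0] by (simp add: F)
      ultimately show ?thesis by (auto simp: F mod_poly_less)
    qed
    then show ?thesis
      using P.truncation_le_term[of P' f 0] degree_mod_less_pos[OF P'.degree_pos, of f]
      by (simp add: P.truncation_low_degree)
  qed
qed (rule P.truncation_valuation P'.truncation_valuation P'.monic P'.degree_pos
      P.truncation_not_Infty | assumption)+

theorem truncation_augmentation: "augmentation (truncation \<nu> P) P' (\<nu> P') (truncation \<nu> P')"
proof -
  have "\<nu> (coeff (expansion P' f) i * P' ^ i) =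
      truncation \<nu> P (coeff (expansion P' f) i) + nmult i (\<nu> P')" for f i
    using degree_coeff_expansion[OF P'.degree_pos, of f i]
    by (simp add: P.truncation_low_degree degree P.val_mult P.val_power)
  then have "truncation \<nu> P' f =
      (MIN i. truncation \<nu> P (coeff (expansion P' f) i) + nmult i (\<nu> P'))" for f
    unfolding truncation_def[of \<nu> P'] by (simp only:)
  then show ?thesis
    using value_increase.is_MLV_key_poly[OF truncation_value_increase] less P'.value_finite
    unfolding augmentation_def by (simp add: truncation_of_better_centre)
qed

text \<open>The difference \<open>P' - P\<close> has no larger value than \<open>P'\<close> under the truncation at \<open>P\<close>.\<close>

lemma not_val_equiv_better_centre: "\<not> val_equiv (truncation \<nu> P) P' P"
proof
  assume "val_equiv (truncation \<nu> P) P' P"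
  then have "truncation \<nu> P P' < truncation \<nu> P (P' - P)"
    by (rule poly_valuation.val_equivD[OF P.truncation_valuation])
      (simp add: truncation_of_better_centre P.value_finite)
  moreover have "truncation \<nu> P (P' - P) = \<nu> P"
    using degree_diff_monic[OF P'.monic P.monic] P.degree_pos
    by (simp add: P.truncation_low_degree degree value_of_difference)
  ultimately show False by (simp add: truncation_of_better_centre)
qed

end


section \<open>The set Psi of a key polynomial\<close>

context poly_valuation
begin

text \<open>The expansion of \<open>f\<close> has the two terms \<open>f - c P\<close> and \<open>c P\<close>, where \<open>c\<close> is the leading coefficient.
  If \<open>f\<close> has a larger value than one of them, then they have equal values, because they cancel.\<close>

lemma truncation_less_same_degree_iff:
  assumes P: "0 < degree P" "lead_coeff P = 1" and f: "degree f = degree P"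
  shows "truncation \<nu> P f < \<nu> f \<longleftrightarrow> \<nu> ([:lead_coeff f:] * P) < \<nu> f"
proof -
  let ?cP = "[:lead_coeff f:] * P"
  have "degree (f - ?cP) < degree P"
  proof (cases "f = ?cP")
    case False
    then show ?thesis using P f by (intro degree_less_if_less_eqI degree_diff_le) auto
  qed (use P in simp)
  then have "truncation \<nu> P (f - ?cP + ?cP) = min (\<nu> (f - ?cP)) (\<nu> ?cP)"
    using P by (intro truncation_linear) auto
  then have trunc: "truncation \<nu> P f = min (\<nu> (f - ?cP)) (\<nu> ?cP)" by simp
  have "\<nu> f \<le> \<nu> (f - ?cP)" if "\<nu> f \<le> \<nu> ?cP" using that by (intro val_ge_diff) auto
  then show ?thesis
    unfolding trunc by (meson min_less_iff_disj not_le)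
qed

context
  fixes P :: "'k poly"
  assumes P: "lead_coeff P = 1" "0 < degree P" and alpha: "alpha \<nu> P = enat (degree P)"
begin

lemma Psi_iff: "f \<in> Psi \<nu> P \<longleftrightarrow> lead_coeff f = 1 \<and> degree f = degree P \<and> \<nu> P < \<nu> f"
  using P by (auto simp: Psi_def alpha truncation_less_same_degree_iff)

text \<open>As \<open>\<alpha> P\<close> is finite, the infimum that defines it is attained, at a polynomial that becomes an
  element of \<open>Psi\<close> once it is made monic.\<close>

lemma Psi_nonempty: "Psi \<nu> P \<noteq> {}"
proof -
  define S where "S = (\<lambda>f. enat (degree f)) ` {f. truncation \<nu> P f < \<nu> f}"
  have Inf: "Inf S = enat (degree P)" using alpha by (simp add: alpha_def S_def)
  then have "S \<noteq> {}" by (auto simp: top_enat_def)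
  then have "Inf S \<in> S" using wellorder_InfI by auto
  then obtain f where f: "truncation \<nu> P f < \<nu> f" "degree f = degree P"
    unfolding Inf by (auto simp: S_def)
  let ?c = "lead_coeff f"
  have "f \<noteq> 0" using f(2) P(2) by auto
  then have c: "?c \<noteq> 0" by simp
  define g where "g = smult (inverse ?c) f"
  have g: "f = [:?c:] * g" using c by (simp add: g_def)
  have "\<nu> ([:?c:] * P) < \<nu> f" using truncation_less_same_degree_iff[OF P(2,1)] f by simp
  then have "\<nu> [:?c:] + \<nu> P < \<nu> [:?c:] + \<nu> g" by (metis g val_mult)
  then have "\<nu> P < \<nu> g" using val_const_finite[OF c] by simp
  then have "g \<in> Psi \<nu> P" unfolding Psi_iff using f c by (simp add: g_def)
  then show ?thesis by auto
qed

end

end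


section \<open>Limit key polynomials\<close>

locale limit_key = poly_valuation +
  fixes Qm Q :: "'a poly"
  assumes limit_key: "limit_key_poly \<nu> Qm Q"
begin

abbreviation "\<Psi> \<equiv> Psi \<nu> Qm"
abbreviation "prec Q' Q'' \<equiv> eps \<nu> Q' < eps \<nu> Q''"

lemma Qm_key: "key_poly \<nu> Qm" and monic_Q: "lead_coeff Q = 1"
  and no_max: "no_maximal (\<nu> ` \<Psi>)"
  and increase_Q: "P \<in> \<Psi> \<Longrightarrow> truncation \<nu> P Q < \<nu> Q"
  and minimal_Q: "(\<And>P. P \<in> \<Psi> \<Longrightarrow> truncation \<nu> P f < \<nu> f) \<Longrightarrow> degree Q \<le> degree f"
  and alpha_Qm: "alpha \<nu> Qm = enat (degree Qm)"
  using limit_key unfolding limit_key_poly_def by blast+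

lemma Qm: "lead_coeff Qm = 1" "0 < degree Qm"
  using Qm_key by (auto simp: key_poly_def)

lemma Psi_D:
  assumes "P \<in> \<Psi>"
  shows "lead_coeff P = 1" "degree P = degree Qm" "\<nu> Qm < \<nu> P"
  using assms unfolding Psi_iff[OF Qm alpha_Qm] by blast+

lemma Psi_not_empty: "\<Psi> \<noteq> {}"
  by (rule Psi_nonempty[OF Qm alpha_Qm])

text \<open>An infinite value would be a maximal one.\<close>

lemma Psi_finite_value:
  assumes "P \<in> \<Psi>"
  shows "\<nu> P \<noteq> Infty"
proof
  assume "\<nu> P = Infty"
  then have "\<forall>s\<in>\<nu> ` \<Psi>. \<not> \<nu> P < s" by simp
  then show False using no_max assms unfolding no_maximal_def by blast
qed

lemma Qm_finite_value: "\<nu> Qm \<noteq> Infty"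
proof -
  obtain P where "P \<in> \<Psi>" using Psi_not_empty by blast
  then show ?thesis using Psi_D(3) less_imp_not_Infty by blast
qed

lemma Psi_key:
  assumes "P \<in> \<Psi>"
  shows "key_poly \<nu> P"
proof -
  have "eps \<nu> Qm < eps \<nu> P"
    using Psi_D[OF assms] by (intro key_poly_eps_increases Qm_key)
  then show ?thesis
    using Psi_D[OF assms] Qm_key unfolding key_poly_def by (metis less_imp_le order_trans)
qed

lemma prec_iff:
  assumes "P \<in> \<Psi>" "P' \<in> \<Psi>"
  shows "prec P P' \<longleftrightarrow> \<nu> P < \<nu> P'"
proof -
  have inc: "eps \<nu> R < eps \<nu> R'" if "\<nu> R < \<nu> R'" "R \<in> \<Psi>" "R' \<in> \<Psi>" for R R'
    using Psi_key Psi_D(1,2) that by (intro key_poly_eps_increases) simp_all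
  have tie: "eps \<nu> R \<le> eps \<nu> R'" if "\<nu> R = \<nu> R'" "R \<in> \<Psi>" "R' \<in> \<Psi>" for R R'
    using Psi_key Psi_D(1,2) Psi_finite_value that by (intro key_poly_eps_tie) simp_all
  show ?thesis
  proof (cases "\<nu> P" "\<nu> P'" rule: linorder_cases)
    case equal
    then show ?thesis using tie[of P' P] assms by auto
  qed (use inc[of P P'] inc[of P' P] assms in auto)
qed

lemma Psi_centre: "P \<in> \<Psi> \<Longrightarrow> truncation_centre \<nu> P"
  by (intro key_poly_truncation_centre Psi_key Psi_finite_value)

lemma Qm_centre: "truncation_centre \<nu> Qm"
  by (intro key_poly_truncation_centre Qm_key Qm_finite_value)

lemma Psi_truncation_valuation: "P \<in> \<Psi> \<Longrightarrow> poly_valuation (truncation \<nu> P)"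
  by (rule truncation_centre.truncation_valuation[OF Psi_centre])

lemma Psi_truncation_le: "P \<in> \<Psi> \<Longrightarrow> truncation \<nu> P f \<le> \<nu> f"
  using Psi_D(2)[of P] Qm by (intro truncation_le) simp

lemma Psi_truncation_mono:
  assumes "P \<in> \<Psi>" "P' \<in> \<Psi>" "\<not> prec P' P"
  shows "truncation \<nu> P f \<le> truncation \<nu> P' f"
  using assms Psi_D(2)[of P] Psi_D(2)[of P']
  by (intro truncation_mono Psi_centre) (auto simp: prec_iff not_less)

lemma Psi_augmentation:
  assumes "P \<in> \<Psi>" "P' \<in> \<Psi>" "prec P P'"
  shows "augmentation (truncation \<nu> P) P' (\<nu> P') (truncation \<nu> P')"
  using assms Psi_D(2)[of P] Psi_D(2)[of P']
  by (intro truncation_augmentation Psi_centre) (auto simp: prec_iff)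

text \<open>Any two elements of \<open>\<Psi>\<close> of different values are related by an augmentation. Hence an immediate
  predecessor can be taken as \<open>\<alpha>\<^sub>-\<close> if there is one, and otherwise any smaller element.\<close>

theorem continued: "continued_family \<Psi> prec (truncation \<nu>) (\<lambda>P. P) \<nu>"
proof -
  have "\<exists>P'\<in>\<Psi>. prec P' P \<and> augmentation (truncation \<nu> P') P (\<nu> P) (truncation \<nu> P) \<and>
      (if \<exists>R. immediate_pred \<Psi> prec R P
       then immediate_pred \<Psi> prec P' P \<and>
         (\<not> smallest \<Psi> prec P' \<longrightarrow>
           \<not> val_equiv (truncation \<nu> P') P P' \<and> degree P' \<le> degree P)
       else (\<forall>R\<in>\<Psi>. prec P' R \<and> prec R P \<longrightarrow>
           augmentation (truncation \<nu> P') R (\<nu> R) (truncation \<nu> R) \<and>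
           augmentation (truncation \<nu> R) P (\<nu> P) (truncation \<nu> P)) \<and>
         degree P = degree P')"
    if P: "P \<in> \<Psi>" "\<not> smallest \<Psi> prec P" for P
  proof (cases "\<exists>R. immediate_pred \<Psi> prec R P")
    case True
    then obtain R where R: "immediate_pred \<Psi> prec R P" by blast
    then have R': "R \<in> \<Psi>" "prec R P" by (auto simp: immediate_pred_def)
    have "\<not> val_equiv (truncation \<nu> R) P R"
      using R' P Psi_D(2)[of P] Psi_D(2)[of R]
      by (intro not_val_equiv_better_centre Psi_centre) (auto simp: prec_iff)
    then show ?thesis
      using True R R' P Psi_D(2)[of P] Psi_D(2)[of R] Psi_augmentation[of R P]
      by (intro bexI[of _ R]) simp_all
  next
    case False
    obtain R where R: "R \<in> \<Psi>" "prec R P" using P by (auto simp: smallest_def)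
    have "degree P = degree R" using Psi_D(2) P R by simp
    then show ?thesis
      using False P R Psi_augmentation by (intro bexI[of _ R] conjI) (simp_all only: if_False, blast)
  qed
  moreover have "total_order_with_ties \<Psi> prec"
    by (auto simp: total_order_with_ties_def)
  moreover have "valuation (truncation \<nu> P)" if "P \<in> \<Psi>" for P
    using Psi_truncation_valuation[OF that] by (rule poly_valuation.valuation)
  ultimately have "augmented_family \<Psi> prec (truncation \<nu>) (\<lambda>P. P) \<nu>"
    unfolding augmented_family_def using Psi_finite_value by blast
  moreover have "valuation (truncation \<nu> Qm)"
    using truncation_centre.truncation_valuation[OF Qm_centre] by (rule poly_valuation.valuation)
  moreover have "augmentation (truncation \<nu> Qm) P (\<nu> P) (truncation \<nu> P)" if "P \<in> \<Psi>" for P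
    using that Psi_D[of P] by (intro truncation_augmentation Qm_centre Psi_centre) simp_all
  ultimately show ?thesis
    unfolding continued_family_def using no_max Psi_D(2) by metis
qed

text \<open>By minimality of the degree of \<open>Q\<close>, some truncation has the full value at \<open>f\<close>; truncations at
  larger elements lie between this one and \<open>\<nu>\<close>.\<close>

lemma eventually_full_value:
  assumes "degree f < degree Q"
  obtains P where "P \<in> \<Psi>" "\<And>P'. P' \<in> \<Psi> \<Longrightarrow> \<not> prec P' P \<Longrightarrow> truncation \<nu> P' f = \<nu> f"
proof -
  obtain P where P: "P \<in> \<Psi>" "\<not> truncation \<nu> P f < \<nu> f"
    using minimal_Q[of f] assms by (meson not_le)
  show ?thesis
  proof (rule that[OF P(1)])
    fix P' assume "P' \<in> \<Psi>" "\<not> prec P' P"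
    then show "truncation \<nu> P' f = \<nu> f"
      using Psi_truncation_mono[of P P' f] Psi_truncation_le[of P' f] P by auto
  qed
qed

text \<open>Otherwise \<open>Q\<close> would be \<open>1\<close>, on which all valuations agree.\<close>

lemma degree_Q: "0 < degree Q"
proof (rule ccontr)
  assume "\<not> 0 < degree Q"
  then obtain c where "Q = [:c:]" by (auto elim: degree_eq_zeroE)
  then have "Q = 1" using monic_Q by simp
  moreover obtain P where "P \<in> \<Psi>" using Psi_not_empty by auto
  ultimately show False
    using increase_Q[of P] poly_valuation.val_one[OF Psi_truncation_valuation, of P] by simp
qed

lemma stable_value_low_degree:
  assumes "degree f < degree Q"
  shows "stable_value \<Psi> prec (truncation \<nu>) f v \<longleftrightarrow> v = \<nu> f"
proof -
  obtain P where P: "P \<in> \<Psi>" "\<And>P'. P' \<in> \<Psi> \<Longrightarrow> \<not> prec P' P \<Longrightarrow> truncation \<nu> P' f = \<nu> f"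
    using eventually_full_value[OF assms] by blast
  have "stable_value \<Psi> prec (truncation \<nu>) f (\<nu> f)"
    unfolding stable_value_def using P by (intro bexI[of _ P]) simp_all
  moreover have "v = \<nu> f" if v: "stable_value \<Psi> prec (truncation \<nu>) f v"
  proof -
    obtain R where R: "R \<in> \<Psi>" "v = truncation \<nu> R f"
      "\<And>P'. P' \<in> \<Psi> \<Longrightarrow> \<not> prec P' R \<Longrightarrow> truncation \<nu> P' f = truncation \<nu> R f"
      using v unfolding stable_value_def by blast
    show ?thesis
    proof (cases "prec P R")
      case True
      then show ?thesis using P(2)[OF R(1)] R(2) by (simp add: less_imp_le not_less)
    next
      case False
      then show ?thesis using R(2) R(3)[OF P(1) False] P(2)[OF P(1)] by simp
    qed
  qed
  ultimately show ?thesis by blast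
qed

lemma family_val_low_degree:
  assumes "degree f < degree Q"
  shows "family_val \<Psi> prec (truncation \<nu>) f = \<nu> f"
  using stable_value_low_degree[OF assms] by (simp add: family_val_def)

theorem limit_augmentation: "limit_augmentation \<Psi> prec (truncation \<nu>) Q (\<nu> Q) (truncation \<nu> Q)"
proof -
  have low: "degree (coeff (expansion Q f) i) < degree Q" for f i
    by (rule degree_coeff_expansion[OF degree_Q])
  have "truncation \<nu> Q f = (MIN i. family_val \<Psi> prec (truncation \<nu>) (coeff (expansion Q f) i)
      + nmult i (\<nu> Q))" for f
    unfolding truncation_def[of \<nu> Q] by (simp add: family_val_low_degree[OF low] val_mult val_power)
  then show ?thesis
    unfolding limit_augmentation_def using increase_Q stable_value_low_degree[OF low] by blast
qed

lemma Psi_truncation_not_Infty: "P \<in> \<Psi> \<Longrightarrow> f \<noteq> 0 \<Longrightarrow> truncation \<nu> P f \<noteq> Infty"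
  by (rule truncation_centre.truncation_not_Infty[OF Psi_centre])

text \<open>From left to right, a strict inequality for large \<open>P\<close> extends downwards, since the truncations
  increase with \<open>P\<close>. From right to left, it suffices that for large \<open>P\<close> the remainder \<open>r\<close> of \<open>f\<close> modulo
  \<open>Q\<close> has a larger truncated value than \<open>f\<close>. For such \<open>P\<close> the truncation has its full value at
  \<open>r\<close>; if that were at most the one of \<open>f\<close>, then \<open>f - r\<close>, a multiple of \<open>Q\<close>, would also have its
  full value, in contradiction to the strict inequality at \<open>Q\<close>.\<close>

theorem family_dvd_iff:
  assumes "f \<noteq> 0"
  shows "family_dvd \<Psi> prec (truncation \<nu>) Q f \<longleftrightarrow> (\<forall>P\<in>\<Psi>. truncation \<nu> P f < \<nu> f)"
proof
  assume "family_dvd \<Psi> prec (truncation \<nu>) Q f"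
  then obtain P where P: "P \<in> \<Psi>"
    and dvd: "\<And>P'. P' \<in> \<Psi> \<Longrightarrow> \<not> prec P' P \<Longrightarrow> val_dvd (truncation \<nu> P') Q f"
    unfolding family_dvd_def by blast
  have eventually: "truncation \<nu> P' f < \<nu> f" if "P' \<in> \<Psi>" "\<not> prec P' P" for P'
    by (rule poly_valuation.val_dvd_imp_value_increase[OF Psi_truncation_valuation[OF that(1)]
          poly_valuation_axioms Psi_truncation_le[OF that(1)] increase_Q[OF that(1)]
          dvd[OF that] Psi_truncation_not_Infty[OF that(1) assms]])
  show "\<forall>P\<in>\<Psi>. truncation \<nu> P f < \<nu> f"
  proof
    fix R assume R: "R \<in> \<Psi>"
    show "truncation \<nu> R f < \<nu> f"
    proof (cases "prec R P")
      case True
      then have "truncation \<nu> R f \<le> truncation \<nu> P f"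
        using R P by (intro Psi_truncation_mono) auto
      also have "\<dots> < \<nu> f" by (rule eventually) (use P in auto)
      finally show ?thesis .
    qed (use eventually R in blast)
  qed
next
  assume incr: "\<forall>P\<in>\<Psi>. truncation \<nu> P f < \<nu> f"
  define r l where "r = f mod Q" and "l = f div Q"
  have f: "f = l * Q + r" by (simp add: r_def l_def)
  have "degree r < degree Q" unfolding r_def by (rule degree_mod_less_pos[OF degree_Q])
  then obtain P where P: "P \<in> \<Psi>"
    and full: "\<And>P'. P' \<in> \<Psi> \<Longrightarrow> \<not> prec P' P \<Longrightarrow> truncation \<nu> P' r = \<nu> r"
    using eventually_full_value by blast
  \<comment> \<open>Otherwise \<open>f\<close> would equal \<open>r\<close>, on which the truncations eventually have the full value.\<close>
  have "l \<noteq> 0"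
    using full[OF P] P incr f by auto
  have "val_dvd (truncation \<nu> P') Q f" if P': "P' \<in> \<Psi>" "\<not> prec P' P" for P'
  proof -
    interpret t: poly_valuation "truncation \<nu> P'" by (rule Psi_truncation_valuation[OF P'(1)])
    have "truncation \<nu> P' f < truncation \<nu> P' r"
    proof (rule ccontr)
      assume "\<not> truncation \<nu> P' f < truncation \<nu> P' r"
      then have le: "\<nu> r \<le> truncation \<nu> P' f" using full[OF P'] by simp
      then have "\<nu> r < \<nu> f" using incr P' by auto
      then have "\<nu> (- r + f) = \<nu> (- r)" by (intro val_add_eq) simp
      then have "\<nu> (l * Q) = \<nu> r" by (simp add: f)
      also have "\<nu> r \<le> truncation \<nu> P' (f - r)"
        using le full[OF P'] by (intro t.val_ge_diff) auto
      also have "truncation \<nu> P' (f - r) = truncation \<nu> P' l + truncation \<nu> P' Q"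
        by (simp add: f t.val_mult)
      also have "\<dots> < \<nu> l + \<nu> Q"
        using Psi_truncation_le increase_Q P' \<open>l \<noteq> 0\<close> Psi_truncation_not_Infty
        by (intro vext_add_le_less_mono) auto
      finally show False by (simp add: val_mult)
    qed
    then show ?thesis unfolding r_def by (rule t.val_dvd_of_large_remainder)
  qed
  then show "family_dvd \<Psi> prec (truncation \<nu>) Q f" unfolding family_dvd_def using P by blast
qed

theorem is_limit_MLV_key_poly: "limit_MLV_key_poly \<Psi> prec (truncation \<nu>) Q"
proof -
  have "family_dvd \<Psi> prec (truncation \<nu>) Q f \<or> family_dvd \<Psi> prec (truncation \<nu>) Q g"
    if dvd: "family_dvd \<Psi> prec (truncation \<nu>) Q (f * g)" for f g
  proof (cases "f = 0 \<or> g = 0")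
    case True
    obtain P where "P \<in> \<Psi>" using Psi_not_empty by auto
    then have "family_dvd \<Psi> prec (truncation \<nu>) Q 0"
      unfolding family_dvd_def
      by (blast intro: poly_valuation.val_dvd_zero Psi_truncation_valuation)
    then show ?thesis using True by blast
  next
    case False
    show ?thesis
    proof (rule ccontr)
      assume "\<not> ?thesis"
      then obtain P P' where P: "P \<in> \<Psi>" "\<nu> f \<le> truncation \<nu> P f"
        and P': "P' \<in> \<Psi>" "\<nu> g \<le> truncation \<nu> P' g"
        using False unfolding de_Morgan_disj by (metis family_dvd_iff not_less)
      define R where "R = (if prec P P' then P' else P)"
      have R: "R \<in> \<Psi>" "\<not> prec R P" "\<not> prec R P'" using P P' by (auto simp: R_def)
      have "\<nu> f \<le> truncation \<nu> R f" "\<nu> g \<le> truncation \<nu> R g"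
        using P P' R Psi_truncation_mono[of P R f] Psi_truncation_mono[of P' R g] by auto
      then have "\<nu> (f * g) \<le> truncation \<nu> R (f * g)"
        using poly_valuation.val_mult[OF Psi_truncation_valuation[OF R(1)]]
        by (simp add: val_mult add_mono)
      moreover have "truncation \<nu> R (f * g) < \<nu> (f * g)"
        using dvd False family_dvd_iff[of "f * g"] R(1) by simp
      ultimately show False by simp
    qed
  qed
  moreover have "degree Q \<le> degree f" if "f \<noteq> 0" "family_dvd \<Psi> prec (truncation \<nu>) Q f" for f
    using that family_dvd_iff minimal_Q by blast
  ultimately show ?thesis unfolding limit_MLV_key_poly_def using monic_Q by blast
qed

end

theorem theorem6p2:
  fixes \<nu> :: "('k::field, 'g::linordered_ab_group_add) pval"
    and Q Q_minus :: "'k poly"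
  assumes "valuation \<nu>"
    and "limit_key_poly \<nu> Q_minus Q"
  defines "A \<equiv> Psi \<nu> Q_minus"
    and "lt \<equiv> \<lambda>Q' Q''. eps \<nu> Q' < eps \<nu> Q''"
    and "V \<equiv> \<lambda>Q'. truncation \<nu> Q'"
  shows "continued_family A lt V (\<lambda>Q'. Q') (\<lambda>Q'. \<nu> Q') \<and>
    limit_MLV_key_poly A lt V Q \<and>
    limit_augmentation A lt V Q (\<nu> Q) (truncation \<nu> Q)"
proof -
  interpret limit_key \<nu> Q_minus Q
    using assms(1,2) by unfold_locales
  show ?thesis
    unfolding A_def lt_def V_def
    using continued is_limit_MLV_key_poly limit_augmentation by blast
qed

end
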